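(* Let $P$ be a parallel-sequential process expression, $B\subseteq Act$, $V$ a valuation, and $\phi$ an $\mathrm{HML}^{check}$ formula. Then $\phi$ holds in the state $\langle\partial_B(P),V\rangle$ of the process algebra with global variables if and only if the translated formula $\theta(\phi)$ holds in the translated mCRL2 process expression $\Psi(P,V)$.
   Context: **Source process algebra.** Fix a data domain $D$, a single global variable $g$ (so $Var=\{g\}$), a set $Act$ of actions and a set $PN$ of process names. Labels: $TL=Act\cup\{assign(g,d)\mid d\in D\}$. A partial, commutative, associative $\gamma:Act\times Act\rightharpoonup Act$ is fixed, such that if $\gamma(a,b)=c$ then $\gamma(c,d)$ is undefined for all $d$. *Sequential* process expressions: $Seq::=Seq+Seq\mid(g=d)\to Seq\mid\lambda.Seq\mid\delta\mid\lambda.X$ with $d\in D$, $\lambda\in TL$, $X\in PN$. A sequential recursive specification $E$ is fixed: one equation $X\stackrel{\mathrm{def}}{=}t$ with $t$ sequential for every $X\in PN$. *Parallel-sequential* expressions: $Par::=Par\|Par\mid X\mid Seq$. A valuation is a map $V:\{g\}\to D$. States are pairs $\langle R,V\rangle$ of a process expression and a valuation; for $B\subseteq Act$ the transitions are the least relation closed under (with $a,b,c\in Act$, $\lambda\in TL$): - $\langle a.P,V\rangle\xrightarrow{a}\langle P,V\rangle$; $\langle assign(g,d).P,V\rangle\xrightarrow{assign(g,d)}\langle P,V[g\mapsto d]\rangle$; - if $\langle P,V\rangle\xrightarrow{\lambda}\langle P',V'\rangle$ then: $\langle (g=d)\to P,V\rangle\xrightarrow{\lambda}\langle P',V'\rangle$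 if $V(g)=d$; $\langle X,V\rangle\xrightarrow{\lambda}\langle P',V'\rangle$ if $X\stackrel{\mathrm{def}}{=}P$; $\langle P+Q,V\rangle\xrightarrow{\lambda}\langle P',V'\rangle$ and $\langle Q+P,V\rangle\xrightarrow{\lambda}\langle P',V'\rangle$; $\langle P\|Q,V\rangle\xrightarrow{\lambda}\langle P'\|Q,V'\rangle$ and $\langle Q\|P,V\rangle\xrightarrow{\lambda}\langle Q\|P',V'\rangle$; $\langle\partial_B(P),V\rangle\xrightarrow{\lambda}\langle\partial_B(P'),V'\rangle$ if $\lambda\notin B$; - if $\langle P,V\rangle\xrightarrow{a}\langle P',V\rangle$, $\langle Q,V\rangle\xrightarrow{b}\langle Q',V\rangle$, $\gamma(a,b)=c$, then $\langle P\|Q,V\rangle\xrightarrow{c}\langle P'\|Q',V\rangle$. **mCRL2 fragment.** Action names: the elements of $Act$ (arity 0) and the names $checkP,checkG,check,assignP,assignG,assign,value$ (arity 2, not in $Act$). Action labels are names applied to data parameters. Multi-actions are $\alpha::=\alpha|\alpha\mid\tau\mid a(d_1,\dots,d_n)$; the semantics $[\![\alpha]\!]$ is the finite multiset of the action labels in $\alpha$ with parameters evaluated ($[\![\tau]\!]$ is empty). Closed data expressions are identified with the values they denote. Process expressions ($\mathcal{P}_{mCRL2}$): $P::=\alpha.P\mid\delta\mid P+P\mid P\|P\mid\nabla_M(P)\mid X(d_1,\dots,d_n)\mid\sum_{d:D}P\mid\tau_I(P)\mid\Gamma_C(P)$. Transitions, labelled by finite multisets of action labels, are the least relation with: $\alpha.P\xrightarrow{[\![\alpha]\!]}P$;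 the usual rules for $+$; $P\|Q\xrightarrow{\alpha}P'\|Q$ if $P\xrightarrow{\alpha}P'$, symmetrically for $Q$, and $P\|Q\xrightarrow{\alpha+\beta}P'\|Q'$ (multiset sum) if $P\xrightarrow{\alpha}P'$ and $Q\xrightarrow{\beta}Q'$; $X(t_1,\dots,t_n)\xrightarrow{\alpha}P'$ if $X(d_1,\dots,d_n)\stackrel{\mathrm{def}}{=}P$ and $P[d_1:=t_1,\dots,d_n:=t_n]\xrightarrow{\alpha}P'$; $\sum_{d:D}P\xrightarrow{\alpha}P'$ if $P[d:=e]\xrightarrow{\alpha}P'$ for some $e\in D$; if $P\xrightarrow{\alpha}P'$ then $\tau_I(P)\xrightarrow{\alpha'}\tau_I(P')$ where $\alpha'$ is $\alpha$ with all labels whose name is in $I$ removed, $\Gamma_C(P)\xrightarrow{\gamma_C(\alpha)}\Gamma_C(P')$, and $\nabla_M(P)\xrightarrow{\alpha}\nabla_M(P')$ provided the multiset of names of $\alpha$ is in $M$ (for $M$ a set of names: $\alpha$ is a single label with name in $M$). Here $C$ is a set of communications $a_1|\dots|a_k\to c$, and $\gamma_C(\alpha)$ is obtained by applying the communications of $C$ successively (in some fixed order), each one exhaustively: for a communication $a_1|\dots|a_k\to c$, as long as labels $a_1(\vec d),\dots,a_k(\vec d)$ with one and the same parameter list $\vec d$ occur together in the multiset, they are replaced by one label $c(\vec d)$. A singleton multiset is identified with its element. **Translation.** For $\epsilon\subseteq D$: $\chi(P_1+P_2,\epsilon)=\chi(P_1,\epsilon)+\chi(P_2,\epsilon)$;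 $\chi((g=d)\to P_1,\epsilon)=\chi(P_1,\epsilon\cup\{d\})$; $\chi(a.P_1,\epsilon)=\sum_{d_1:D}(a|checkP(d_1,\bigwedge_{d\in\epsilon}d_1\approx d)).\chi(P_1,\emptyset)$ for $a\in Act$; $\chi(assign(g,d').P_1,\epsilon)=\sum_{d_1:D}(assignP(g,d')|checkP(d_1,\bigwedge_{d\in\epsilon}d_1\approx d)).\chi(P_1,\emptyset)$; $\chi(X,\epsilon)=X$; $\chi(\delta,\epsilon)=\delta$; $\chi(P_1\|P_2,\emptyset)=\chi(P_1,\emptyset)\|\chi(P_2,\emptyset)$. ($\approx$ is equality; the empty conjunction is true.) The mCRL2 recursive specification has $X\stackrel{\mathrm{def}}{=}\chi(t,\emptyset)$ for each equation $X\stackrel{\mathrm{def}}{=}t$ of $E$, and $$Globs(d:D)\stackrel{\mathrm{def}}{=}checkG(d,true).Globs(d)+(checkG(d,true)|checkG(d,true)).Globs(d)+\sum_{new:D}(checkG(d,true)|assignG(g,new)).Globs(new)+value(g,d).Globs(d).$$ Let $C_\gamma$ contain, for each $\gamma(a,b)=c$, exactly one of $a|b\to c$, $b|a\to c$; $C_{G\gamma}=C_\gamma\cup\{assignP|assignG\to assign,\ checkP|checkG\to check\}$; $A_B=(Act\setminus B)\cup\{value,assign\}$. Then $\Psi(P,V)=\nabla_{A_B}(\tau_{\{check\}}(\Gamma_{C_{G\gamma}}(\chi(P,\emptyset)\|Globs(V(g)))))$. **Logic.** $\mathrm{HML}^{check}$ formulas: $\phi::=true\mid false\mid(v=e)\mid\neg\phi\mid\phi\wedge\phi\mid\phi\vee\phi\mid\langle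 T\rangle\phi\mid[T]\phi$, with $v\in Var=\{g\}$, $e\in D$, $T$ a nonempty finite set of transition labels in $TL$. $(v=e)$ holds in $\langle R,V\rangle$ iff $V(v)=e$; $\langle T\rangle\phi$ holds in $s$ iff $s\xrightarrow{\lambda}s'$ for some $\lambda\in T$ and some $s'$ in which $\phi$ holds; $[T]\phi$ holds in $s$ iff $\phi$ holds in every $s'$ with $s\xrightarrow{\lambda}s'$, $\lambda\in T$; Boolean connectives as usual. $\theta$ replaces every subformula $(v=e)$ by $\langle\{value(v,e)\}\rangle true$ and commutes with all other constructs; $\theta(\phi)$ is interpreted (as plain Hennessy–Milner logic) in the mCRL2 transition system. *)

theory Defs
  imports Main "HOL-Library.FSet" "HOL-Library.Multiset"
begin

section \<open>The process algebra with one global variable\<close>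

text \<open>Type parameters: \<open>'a\<close> is the set of actions, \<open>'d\<close> the data domain, \<open>'x\<close> the set of
  process names. \<open>gvar\<close> is the set of variables, consisting of the single variable \<open>G\<close>.\<close>

datatype gvar = G

type_synonym 'd valuation = "gvar \<Rightarrow> 'd"

datatype ('a, 'd) lab = Act 'a | Assign gvar 'd

datatype ('a, 'd, 'x) pexpr =
    Alt "('a, 'd, 'x) pexpr" "('a, 'd, 'x) pexpr"
  | Guard gvar 'd "('a, 'd, 'x) pexpr"
  | Pre "('a, 'd) lab" "('a, 'd, 'x) pexpr"
  | Delta
  | PVar 'x
  | Par "('a, 'd, 'x) pexpr" "('a, 'd, 'x) pexpr"
  | Encap "'a set" "('a, 'd, 'x) pexpr"

inductive sequential :: "('a, 'd, 'x) pexpr \<Rightarrow> bool" where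
  "sequential P \<Longrightarrow> sequential Q \<Longrightarrow> sequential (Alt P Q)"
| "sequential P \<Longrightarrow> sequential (Guard v d P)"
| "sequential P \<Longrightarrow> sequential (Pre l P)"
| "sequential Delta"
| "sequential (Pre l (PVar X))"

inductive par_sequential :: "('a, 'd, 'x) pexpr \<Rightarrow> bool" where
  "par_sequential P \<Longrightarrow> par_sequential Q \<Longrightarrow> par_sequential (Par P Q)"
| "par_sequential (PVar X)"
| "sequential P \<Longrightarrow> par_sequential P"

definition communication_function :: "('a \<Rightarrow> 'a \<Rightarrow> 'a option) \<Rightarrow> bool" where
  "communication_function \<gamma> \<longleftrightarrow>
     (\<forall>a b. \<gamma> a b = \<gamma> b a) \<and>
     (\<forall>a b c. Option.bind (\<gamma> a b) (\<lambda>x. \<gamma> x c) = Option.bind (\<gamma> b c) (\<lambda>x. \<gamma> a x)) \<and>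
     (\<forall>a b c d. \<gamma> a b = Some c \<longrightarrow> \<gamma> c d = None)"

inductive trans_pa ::
  "('a \<Rightarrow> 'a \<Rightarrow> 'a option) \<Rightarrow> ('x \<Rightarrow> ('a, 'd, 'x) pexpr) \<Rightarrow>
   ('a, 'd, 'x) pexpr \<times> 'd valuation \<Rightarrow> ('a, 'd) lab \<Rightarrow>
   ('a, 'd, 'x) pexpr \<times> 'd valuation \<Rightarrow> bool"
  for \<gamma> :: "'a \<Rightarrow> 'a \<Rightarrow> 'a option" and E :: "'x \<Rightarrow> ('a, 'd, 'x) pexpr" where
  act: "trans_pa \<gamma> E (Pre (Act a) P, V) (Act a) (P, V)"
| assign: "trans_pa \<gamma> E (Pre (Assign v d) P, V) (Assign v d) (P, V(v := d))"
| guard: "trans_pa \<gamma> E (P, V) l (P', V') \<Longrightarrow> V v = d \<Longrightarrow>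
    trans_pa \<gamma> E (Guard v d P, V) l (P', V')"
| rec: "trans_pa \<gamma> E (E X, V) l (P', V') \<Longrightarrow> trans_pa \<gamma> E (PVar X, V) l (P', V')"
| alt_left: "trans_pa \<gamma> E (P, V) l (P', V') \<Longrightarrow> trans_pa \<gamma> E (Alt P Q, V) l (P', V')"
| alt_right: "trans_pa \<gamma> E (P, V) l (P', V') \<Longrightarrow> trans_pa \<gamma> E (Alt Q P, V) l (P', V')"
| par_left: "trans_pa \<gamma> E (P, V) l (P', V') \<Longrightarrow>
    trans_pa \<gamma> E (Par P Q, V) l (Par P' Q, V')"
| par_right: "trans_pa \<gamma> E (P, V) l (P', V') \<Longrightarrow>
    trans_pa \<gamma> E (Par Q P, V) l (Par Q P', V')"
| encap: "trans_pa \<gamma> E (P, V) l (P', V') \<Longrightarrow> l \<notin> Act ` B \<Longrightarrow>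
    trans_pa \<gamma> E (Encap B P, V) l (Encap B P', V')"
| comm: "trans_pa \<gamma> E (P, V) (Act a) (P', V) \<Longrightarrow> trans_pa \<gamma> E (Q, V) (Act b) (Q', V) \<Longrightarrow>
    \<gamma> a b = Some c \<Longrightarrow> trans_pa \<gamma> E (Par P Q, V) (Act c) (Par P' Q', V)"


section \<open>The mCRL2 fragment\<close>

datatype 'd dval = DatV 'd | BoolV bool | VarV gvar

type_synonym dvar = string

text \<open>All data variables have sort \<open>D\<close>. \<open>DConj\<close> is the conjunction of a finite set of
  Boolean expressions.\<close>

datatype 'd dexp =
    DVar dvar
  | DVal "'d dval"
  | DEq "'d dexp" "'d dexp"
  | DConj "'d dexp fset"

text \<open>The value of a closed data expression; the result on open expressions is irrelevant.\<close>

primrec deval :: "'d dexp \<Rightarrow> 'd dval" where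
  "deval (DVar x) = undefined"
| "deval (DVal v) = v"
| "deval (DEq s t) = BoolV (deval s = deval t)"
| "deval (DConj ts) = BoolV (fBall (deval |`| ts) (\<lambda>v. v = BoolV True))"

text \<open>Simultaneous substitution. Only values are substituted, so variable capture cannot
  occur.\<close>

primrec dsubst :: "(dvar \<rightharpoonup> 'd dval) \<Rightarrow> 'd dexp \<Rightarrow> 'd dexp" where
  "dsubst \<sigma> (DVar x) = (case \<sigma> x of None \<Rightarrow> DVar x | Some v \<Rightarrow> DVal v)"
| "dsubst \<sigma> (DVal v) = DVal v"
| "dsubst \<sigma> (DEq s t) = DEq (dsubst \<sigma> s) (dsubst \<sigma> t)"
| "dsubst \<sigma> (DConj ts) = DConj (dsubst \<sigma> |`| ts)"

datatype 'a aname =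
  NAct 'a | NCheckP | NCheckG | NCheck | NAssignP | NAssignG | NAssign | NValue

type_synonym ('a, 'd) alab = "'a aname \<times> 'd dval list"

datatype ('a, 'd) mact =
    MBar "('a, 'd) mact" "('a, 'd) mact"
  | MTau
  | MAct "'a aname" "'d dexp list"

primrec msem :: "('a, 'd) mact \<Rightarrow> ('a, 'd) alab multiset" where
  "msem (MBar \<alpha> \<beta>) = msem \<alpha> + msem \<beta>"
| "msem MTau = {#}"
| "msem (MAct n ts) = {#(n, map deval ts)#}"

primrec msubst :: "(dvar \<rightharpoonup> 'd dval) \<Rightarrow> ('a, 'd) mact \<Rightarrow> ('a, 'd) mact" where
  "msubst \<sigma> (MBar \<alpha> \<beta>) = MBar (msubst \<sigma> \<alpha>) (msubst \<sigma> \<beta>)"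
| "msubst \<sigma> MTau = MTau"
| "msubst \<sigma> (MAct n ts) = MAct n (map (dsubst \<sigma>) ts)"

text \<open>\<open>([a\<^sub>1, \<dots>, a\<^sub>k], c)\<close> is the communication \<open>a\<^sub>1|\<dots>|a\<^sub>k \<rightarrow> c\<close>.\<close>

type_synonym 'a communication = "'a aname list \<times> 'a aname"

datatype 'x mname = PName 'x | Globs

datatype ('a, 'd, 'x) mproc =
    MPre "('a, 'd) mact" "('a, 'd, 'x) mproc"
  | MDelta
  | MAlt "('a, 'd, 'x) mproc" "('a, 'd, 'x) mproc"
  | MPar "('a, 'd, 'x) mproc" "('a, 'd, 'x) mproc"
  | MAllow "'a aname multiset set" "('a, 'd, 'x) mproc"
  | MCall "'x mname" "'d dexp list"
  | MSum dvar "('a, 'd, 'x) mproc"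
  | MHide "'a aname set" "('a, 'd, 'x) mproc"
  | MComm "'a communication set" "('a, 'd, 'x) mproc"

primrec psubst :: "(dvar \<rightharpoonup> 'd dval) \<Rightarrow> ('a, 'd, 'x) mproc \<Rightarrow> ('a, 'd, 'x) mproc" where
  "psubst \<sigma> (MPre \<alpha> P) = MPre (msubst \<sigma> \<alpha>) (psubst \<sigma> P)"
| "psubst \<sigma> MDelta = MDelta"
| "psubst \<sigma> (MAlt P Q) = MAlt (psubst \<sigma> P) (psubst \<sigma> Q)"
| "psubst \<sigma> (MPar P Q) = MPar (psubst \<sigma> P) (psubst \<sigma> Q)"
| "psubst \<sigma> (MAllow M P) = MAllow M (psubst \<sigma> P)"
| "psubst \<sigma> (MCall N ts) = MCall N (map (dsubst \<sigma>) ts)"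
| "psubst \<sigma> (MSum x P) = MSum x (psubst (\<sigma>(x := None)) P)"
| "psubst \<sigma> (MHide I P) = MHide I (psubst \<sigma> P)"
| "psubst \<sigma> (MComm C P) = MComm C (psubst \<sigma> P)"

definition comm_step ::
  "'a communication \<Rightarrow> ('a, 'd) alab multiset \<Rightarrow> ('a, 'd) alab multiset \<Rightarrow> bool" where
  "comm_step k \<alpha> \<beta> \<longleftrightarrow>
     (\<exists>ds \<rho>. \<alpha> = \<rho> + mset (map (\<lambda>a. (a, ds)) (fst k)) \<and> \<beta> = \<rho> + {#(snd k, ds)#})"

definition comm_exhaust ::
  "'a communication \<Rightarrow> ('a, 'd) alab multiset \<Rightarrow> ('a, 'd) alab multiset \<Rightarrow> bool" where
  "comm_exhaust k \<alpha> \<beta> \<longleftrightarrow> (comm_step k)\<^sup>*\<^sup>* \<alpha> \<beta> \<and> \<not> (\<exists>\<beta>'. comm_step k \<beta> \<beta>')"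

text \<open>\<open>comm_apply r C \<alpha> \<beta>\<close> is the graph of \<open>\<alpha> \<mapsto> \<gamma>\<^sub>C(\<alpha>)\<close>, where the communications are
  applied in the order given by the well-order \<open>r\<close>. No finiteness of \<open>C\<close> is
  required: communications that are not applicable when their turn comes have no effect
  and are skipped, so the next one to act is the \<open>r\<close>-least applicable one, after which only
  the communications strictly above it remain.\<close>

inductive comm_apply ::
  "'a communication rel \<Rightarrow> 'a communication set \<Rightarrow>
   ('a, 'd) alab multiset \<Rightarrow> ('a, 'd) alab multiset \<Rightarrow> bool"
  for r :: "'a communication rel" where
  finished: "\<forall>k\<in>C. \<not> (\<exists>\<alpha>'. comm_step k \<alpha> \<alpha>') \<Longrightarrow> comm_apply r C \<alpha> \<alpha>"
| least: "k \<in> C \<Longrightarrow> \<exists>\<alpha>'. comm_step k \<alpha> \<alpha>' \<Longrightarrow>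
    \<forall>k'\<in>C. (\<exists>\<alpha>'. comm_step k' \<alpha> \<alpha>') \<longrightarrow> (k, k') \<in> r \<Longrightarrow>
    comm_exhaust k \<alpha> \<beta> \<Longrightarrow> comm_apply r {k' \<in> C. (k, k') \<in> r \<and> k' \<noteq> k} \<beta> \<beta>' \<Longrightarrow>
    comm_apply r C \<alpha> \<beta>'"

text \<open>A specification \<open>S\<close> maps each name to its formal parameters and its body. Closed data
  expressions are identified with their values, so actual parameters are evaluated.\<close>

inductive trans_m ::
  "'a communication rel \<Rightarrow> ('x mname \<Rightarrow> dvar list \<times> ('a, 'd, 'x) mproc) \<Rightarrow>
   ('a, 'd, 'x) mproc \<Rightarrow> ('a, 'd) alab multiset \<Rightarrow> ('a, 'd, 'x) mproc \<Rightarrow> bool"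
  for r :: "'a communication rel"
    and S :: "'x mname \<Rightarrow> dvar list \<times> ('a, 'd, 'x) mproc" where
  pre: "trans_m r S (MPre \<alpha> P) (msem \<alpha>) P"
| alt_left: "trans_m r S P \<alpha> P' \<Longrightarrow> trans_m r S (MAlt P Q) \<alpha> P'"
| alt_right: "trans_m r S Q \<alpha> Q' \<Longrightarrow> trans_m r S (MAlt P Q) \<alpha> Q'"
| par_left: "trans_m r S P \<alpha> P' \<Longrightarrow> trans_m r S (MPar P Q) \<alpha> (MPar P' Q)"
| par_right: "trans_m r S Q \<alpha> Q' \<Longrightarrow> trans_m r S (MPar P Q) \<alpha> (MPar P Q')"
| par_both: "trans_m r S P \<alpha> P' \<Longrightarrow> trans_m r S Q \<beta> Q' \<Longrightarrow>
    trans_m r S (MPar P Q) (\<alpha> + \<beta>) (MPar P' Q')"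
| call: "S N = (xs, P) \<Longrightarrow> length ts = length xs \<Longrightarrow>
    trans_m r S (psubst (map_of (zip xs (map deval ts))) P) \<alpha> P' \<Longrightarrow>
    trans_m r S (MCall N ts) \<alpha> P'"
| sum: "trans_m r S (psubst [x \<mapsto> DatV e] P) \<alpha> P' \<Longrightarrow> trans_m r S (MSum x P) \<alpha> P'"
| hide: "trans_m r S P \<alpha> P' \<Longrightarrow>
    trans_m r S (MHide I P) (filter_mset (\<lambda>l. fst l \<notin> I) \<alpha>) (MHide I P')"
| comm: "trans_m r S P \<alpha> P' \<Longrightarrow> comm_apply r C \<alpha> \<beta> \<Longrightarrow>
    trans_m r S (MComm C P) \<beta> (MComm C P')"
| allow: "trans_m r S P \<alpha> P' \<Longrightarrow> image_mset fst \<alpha> \<in> M \<Longrightarrow>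
    trans_m r S (MAllow M P) \<alpha> (MAllow M P')"


section \<open>The translation\<close>

text \<open>The expression \<open>checkP(d\<^sub>1, \<And>\<^bsub>d\<in>\<epsilon>\<^esub> d\<^sub>1 \<approx> d)\<close>.\<close>

definition checkP :: "'d fset \<Rightarrow> ('a, 'd) mact" where
  "checkP \<epsilon> = MAct NCheckP
     [DVar ''d1'', DConj ((\<lambda>d. DEq (DVar ''d1'') (DVal (DatV d))) |`| \<epsilon>)]"

text \<open>The sets \<open>\<epsilon>\<close> that arise are finite, as the conjunction requires. The \<open>undefined\<close> cases
  are those in which the translation is not defined; they do not arise from
  parallel-sequential expressions.\<close>

fun chi :: "('a, 'd, 'x) pexpr \<Rightarrow> 'd fset \<Rightarrow> ('a, 'd, 'x) mproc" where
  "chi (Alt P Q) \<epsilon> = MAlt (chi P \<epsilon>) (chi Q \<epsilon>)"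
| "chi (Guard v d P) \<epsilon> = chi P (finsert d \<epsilon>)"
| "chi (Pre (Act a) P) \<epsilon> =
     MSum ''d1'' (MPre (MBar (MAct (NAct a) []) (checkP \<epsilon>)) (chi P {||}))"
| "chi (Pre (Assign v d) P) \<epsilon> =
     MSum ''d1'' (MPre (MBar (MAct NAssignP [DVal (VarV v), DVal (DatV d)]) (checkP \<epsilon>))
       (chi P {||}))"
| "chi (PVar X) \<epsilon> = MCall (PName X) []"
| "chi Delta \<epsilon> = MDelta"
| "chi (Par P Q) \<epsilon> = (if \<epsilon> = {||} then MPar (chi P {||}) (chi Q {||}) else undefined)"
| "chi (Encap B P) \<epsilon> = undefined"

definition globs_body :: "('a, 'd, 'x) mproc" where
  "globs_body =
    (let d = DVar ''d''; new = DVar ''new'';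
         checkG = MAct NCheckG [d, DVal (BoolV True)];
         assignG = MAct NAssignG [DVal (VarV G), new];
         val = MAct NValue [DVal (VarV G), d]
     in MAlt (MAlt (MAlt
          (MPre checkG (MCall Globs [d]))
          (MPre (MBar checkG checkG) (MCall Globs [d])))
          (MSum ''new'' (MPre (MBar checkG assignG) (MCall Globs [new]))))
          (MPre val (MCall Globs [d])))"

primrec mspec ::
  "('x \<Rightarrow> ('a, 'd, 'x) pexpr) \<Rightarrow> 'x mname \<Rightarrow> dvar list \<times> ('a, 'd, 'x) mproc" where
  "mspec E (PName X) = ([], chi (E X) {||})"
| "mspec E Globs = ([''d''], globs_body)"

definition comm_choice :: "('a \<Rightarrow> 'a \<Rightarrow> 'a option) \<Rightarrow> 'a communication set \<Rightarrow> bool" where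
  "comm_choice \<gamma> C \<longleftrightarrow>
     C \<subseteq> {([NAct a, NAct b], NAct c) | a b c. \<gamma> a b = Some c} \<and>
     (\<forall>a b c. \<gamma> a b = Some c \<longrightarrow>
        (\<exists>!k. k \<in> {([NAct a, NAct b], NAct c), ([NAct b, NAct a], NAct c)} \<and> k \<in> C))"

definition comm_G :: "'a communication set \<Rightarrow> 'a communication set" where
  "comm_G C = C \<union> {([NAssignP, NAssignG], NAssign), ([NCheckP, NCheckG], NCheck)}"

definition allowed :: "'a set \<Rightarrow> 'a aname set" where
  "allowed B = NAct ` (UNIV - B) \<union> {NValue, NAssign}"

definition Psi ::
  "'a communication set \<Rightarrow> 'a set \<Rightarrow> ('a, 'd, 'x) pexpr \<Rightarrow> 'd valuation \<Rightarrow>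
   ('a, 'd, 'x) mproc" where
  "Psi C B P V =
     MAllow ((\<lambda>n. {#n#}) ` allowed B)
       (MHide {NCheck}
         (MComm (comm_G C)
           (MPar (chi P {||}) (MCall Globs [DVal (DatV (V G))]))))"


section \<open>Logics\<close>

datatype ('a, 'd) hml_check =
    CTrue
  | CFalse
  | CCheck gvar 'd
  | CNot "('a, 'd) hml_check"
  | CAnd "('a, 'd) hml_check" "('a, 'd) hml_check"
  | COr "('a, 'd) hml_check" "('a, 'd) hml_check"
  | CDia "('a, 'd) lab set" "('a, 'd) hml_check"
  | CBox "('a, 'd) lab set" "('a, 'd) hml_check"

primrec wf_check :: "('a, 'd) hml_check \<Rightarrow> bool" where
  "wf_check CTrue \<longleftrightarrow> True"
| "wf_check CFalse \<longleftrightarrow> True"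
| "wf_check (CCheck v e) \<longleftrightarrow> True"
| "wf_check (CNot \<phi>) \<longleftrightarrow> wf_check \<phi>"
| "wf_check (CAnd \<phi> \<psi>) \<longleftrightarrow> wf_check \<phi> \<and> wf_check \<psi>"
| "wf_check (COr \<phi> \<psi>) \<longleftrightarrow> wf_check \<phi> \<and> wf_check \<psi>"
| "wf_check (CDia T \<phi>) \<longleftrightarrow> finite T \<and> T \<noteq> {} \<and> wf_check \<phi>"
| "wf_check (CBox T \<phi>) \<longleftrightarrow> finite T \<and> T \<noteq> {} \<and> wf_check \<phi>"

primrec sat_check ::
  "('a \<Rightarrow> 'a \<Rightarrow> 'a option) \<Rightarrow> ('x \<Rightarrow> ('a, 'd, 'x) pexpr) \<Rightarrow>
   ('a, 'd) hml_check \<Rightarrow> ('a, 'd, 'x) pexpr \<times> 'd valuation \<Rightarrow> bool" where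
  "sat_check \<gamma> E CTrue s \<longleftrightarrow> True"
| "sat_check \<gamma> E CFalse s \<longleftrightarrow> False"
| "sat_check \<gamma> E (CCheck v e) s \<longleftrightarrow> snd s v = e"
| "sat_check \<gamma> E (CNot \<phi>) s \<longleftrightarrow> \<not> sat_check \<gamma> E \<phi> s"
| "sat_check \<gamma> E (CAnd \<phi> \<psi>) s \<longleftrightarrow> sat_check \<gamma> E \<phi> s \<and> sat_check \<gamma> E \<psi> s"
| "sat_check \<gamma> E (COr \<phi> \<psi>) s \<longleftrightarrow> sat_check \<gamma> E \<phi> s \<or> sat_check \<gamma> E \<psi> s"
| "sat_check \<gamma> E (CDia T \<phi>) s \<longleftrightarrow> (\<exists>l\<in>T. \<exists>s'. trans_pa \<gamma> E s l s' \<and> sat_check \<gamma> E \<phi> s')"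
| "sat_check \<gamma> E (CBox T \<phi>) s \<longleftrightarrow> (\<forall>l\<in>T. \<forall>s'. trans_pa \<gamma> E s l s' \<longrightarrow> sat_check \<gamma> E \<phi> s')"

datatype 'l hml =
    HTrue
  | HFalse
  | HNot "'l hml"
  | HAnd "'l hml" "'l hml"
  | HOr "'l hml" "'l hml"
  | HDia "'l set" "'l hml"
  | HBox "'l set" "'l hml"

primrec sat :: "('s \<Rightarrow> 'l \<Rightarrow> 's \<Rightarrow> bool) \<Rightarrow> 'l hml \<Rightarrow> 's \<Rightarrow> bool" where
  "sat R HTrue s \<longleftrightarrow> True"
| "sat R HFalse s \<longleftrightarrow> False"
| "sat R (HNot \<phi>) s \<longleftrightarrow> \<not> sat R \<phi> s"
| "sat R (HAnd \<phi> \<psi>) s \<longleftrightarrow> sat R \<phi> s \<and> sat R \<psi> s"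
| "sat R (HOr \<phi> \<psi>) s \<longleftrightarrow> sat R \<phi> s \<or> sat R \<psi> s"
| "sat R (HDia T \<phi>) s \<longleftrightarrow> (\<exists>l\<in>T. \<exists>s'. R s l s' \<and> sat R \<phi> s')"
| "sat R (HBox T \<phi>) s \<longleftrightarrow> (\<forall>l\<in>T. \<forall>s'. R s l s' \<longrightarrow> sat R \<phi> s')"

text \<open>A label of the source algebra read as a (singleton) multi-action.\<close>

primrec mlab :: "('a, 'd) lab \<Rightarrow> ('a, 'd) alab multiset" where
  "mlab (Act a) = {#(NAct a, [])#}"
| "mlab (Assign v d) = {#(NAssign, [VarV v, DatV d])#}"

primrec theta :: "('a, 'd) hml_check \<Rightarrow> ('a, 'd) alab multiset hml" where
  "theta CTrue = HTrue"
| "theta CFalse = HFalse"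
| "theta (CCheck v e) = HDia {{#(NValue, [VarV v, DatV e])#}} HTrue"
| "theta (CNot \<phi>) = HNot (theta \<phi>)"
| "theta (CAnd \<phi> \<psi>) = HAnd (theta \<phi>) (theta \<psi>)"
| "theta (COr \<phi> \<psi>) = HOr (theta \<phi>) (theta \<psi>)"
| "theta (CDia T \<phi>) = HDia (mlab ` T) (theta \<phi>)"
| "theta (CBox T \<phi>) = HBox (mlab ` T) (theta \<phi>)"

end

(* A component of chi P that moves contributes its own label together with one checkP, and
   Globs offers at most two checkG, one for each process taking part in a synchronisation.
   Only single labels other than checkP, checkG, assignP and assignG are allowed, so in an
   allowed transition every checkP meets a checkG with the same parameters (hence all guards
   hold for the current value of g), and either one component acts or exactly two components
   synchronise. The targets are again literally of the form Psi P' V', so apart from the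
   value loops the two transition systems coincide and the formulas transfer by induction.

   Since no result of a communication is an argument of another one, an inapplicable
   communication never becomes applicable again. Applying the communications in any order
   therefore ends in a normal form, and it suffices to count labels. *)

theory Submission
  imports Defs
begin

section \<open>Communication as rewriting\<close>

definition enabled :: "'a communication \<Rightarrow> ('a, 'd) alab multiset \<Rightarrow> bool" where
  "enabled k \<alpha> \<longleftrightarrow> (\<exists>\<beta>. comm_step k \<alpha> \<beta>)"

definition any_step ::
  "'a communication set \<Rightarrow> ('a, 'd) alab multiset \<Rightarrow> ('a, 'd) alab multiset \<Rightarrow> bool" where
  "any_step C \<alpha> \<beta> \<longleftrightarrow> (\<exists>k\<in>C. comm_step k \<alpha> \<beta>)"

definition non_cascading :: "'a communication set \<Rightarrow> bool" where
  "non_cascading C \<longleftrightarrow> (\<forall>k\<in>C. \<forall>k'\<in>C. snd k \<notin> set (fst k'))"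

lemma comm_step_iff:
  "comm_step k \<alpha> \<beta> \<longleftrightarrow>
    (\<exists>ds \<rho>. \<alpha> = \<rho> + image_mset (\<lambda>a. (a, ds)) (mset (fst k)) \<and> \<beta> = add_mset (snd k, ds) \<rho>)"
  by (simp add: comm_step_def)

lemma enabled_iff:
  "enabled k \<alpha> \<longleftrightarrow> (\<exists>ds. image_mset (\<lambda>a. (a, ds)) (mset (fst k)) \<subseteq># \<alpha>)"
  by (auto simp: enabled_def comm_step_iff mset_subset_eq_exists_conv add.commute)

lemma any_step_mono: "any_step C \<alpha> \<beta> \<Longrightarrow> C \<subseteq> C' \<Longrightarrow> any_step C' \<alpha> \<beta>"
  by (auto simp: any_step_def)

lemma any_steps_mono: "(any_step C)\<^sup>*\<^sup>* \<alpha> \<beta> \<Longrightarrow> C \<subseteq> C' \<Longrightarrow> (any_step C')\<^sup>*\<^sup>* \<alpha> \<beta>"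
  using rtranclp_mono[of "any_step C" "any_step C'"] any_step_mono[of C _ _ C'] by blast

lemma comm_exhaust_steps:
  assumes "comm_exhaust k \<alpha> \<beta>" "k \<in> C"
  shows "(any_step C)\<^sup>*\<^sup>* \<alpha> \<beta>"
proof -
  have "comm_step k \<le> any_step C" using assms(2) by (auto simp: any_step_def)
  then have "(comm_step k)\<^sup>*\<^sup>* \<le> (any_step C)\<^sup>*\<^sup>*" by (rule rtranclp_mono)
  then show ?thesis using assms(1) by (auto simp: comm_exhaust_def)
qed

text \<open>Forgets the order \<open>r\<close>: whatever single communication steps preserve in any
  order then holds for every result of \<open>comm_apply\<close>.\<close>

lemma comm_apply_steps: "comm_apply r C \<alpha> \<beta> \<Longrightarrow> (any_step C)\<^sup>*\<^sup>* \<alpha> \<beta>"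
proof (induction rule: comm_apply.induct)
  case (least k C \<alpha> \<beta> \<beta>')
  have "(any_step C)\<^sup>*\<^sup>* \<alpha> \<beta>" using least by (blast intro: comm_exhaust_steps)
  also have "(any_step C)\<^sup>*\<^sup>* \<beta> \<beta>'" using least.IH by (rule any_steps_mono) auto
  finally show ?case .
qed simp

lemma subseteq_add_mset_notin: "x \<notin># A \<Longrightarrow> A \<subseteq># add_mset x B \<Longrightarrow> A \<subseteq># B"
  by (metis count_add_mset count_eq_zero_iff le0 subseteq_mset_def)

text \<open>The only new label of \<beta> is the result of some \<open>k'\<close>, which is no
  argument of \<open>k\<close>. Arguments of \<open>k\<close> that occur together in \<beta>
  therefore lie in the untouched remainder \<rho> and were already present in \<alpha>.\<close>

lemma disabled_step:
  assumes "any_step C \<alpha> \<beta>" "non_cascading C" "k \<in> C" "\<not> enabled k \<alpha>"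
  shows "\<not> enabled k \<beta>"
proof
  assume "enabled k \<beta>"
  then obtain ds where ds: "image_mset (\<lambda>a. (a, ds)) (mset (fst k)) \<subseteq># \<beta>"
    by (auto simp: enabled_iff)
  obtain k' ds' \<rho> where k': "k' \<in> C"
    "\<alpha> = \<rho> + image_mset (\<lambda>a. (a, ds')) (mset (fst k'))" "\<beta> = add_mset (snd k', ds') \<rho>"
    using assms(1) by (auto simp: any_step_def comm_step_iff)
  have "(snd k', ds') \<notin># image_mset (\<lambda>a. (a, ds)) (mset (fst k))"
    using assms(2,3) k'(1) by (auto simp: non_cascading_def)
  then have "image_mset (\<lambda>a. (a, ds)) (mset (fst k)) \<subseteq># \<rho>"
    using ds unfolding k'(3) by (rule subseteq_add_mset_notin)
  then have "image_mset (\<lambda>a. (a, ds)) (mset (fst k)) \<subseteq># \<alpha>"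
    unfolding k'(2) by (meson mset_subset_eq_add_left subset_mset.order_trans)
  then show False using assms(4) by (auto simp: enabled_iff)
qed

lemma disabled_steps:
  assumes "(any_step C)\<^sup>*\<^sup>* \<alpha> \<beta>" "non_cascading C" "k \<in> C" "\<not> enabled k \<alpha>"
  shows "\<not> enabled k \<beta>"
  using assms by (induction rule: rtranclp_induct) (auto dest: disabled_step)

lemma non_cascading_subset: "non_cascading C \<Longrightarrow> C' \<subseteq> C \<Longrightarrow> non_cascading C'"
  by (auto simp: non_cascading_def)

text \<open>Communications that remain after \<open>m\<close> are covered by the induction. Any
  other one is \<open>m\<close> itself, just exhausted, or was already disabled when
  \<open>m\<close> was chosen, and disabled communications stay disabled.\<close>

lemma comm_apply_normal:
  "comm_apply r C \<alpha> \<beta> \<Longrightarrow> non_cascading C \<Longrightarrow> k \<in> C \<Longrightarrow> \<not> enabled k \<beta>"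
proof (induction arbitrary: k rule: comm_apply.induct)
  case (finished C \<alpha>)
  then show ?case by (auto simp: enabled_def)
next
  case (least m C \<alpha> \<beta> \<beta>')
  let ?C' = "{k' \<in> C. (m, k') \<in> r \<and> k' \<noteq> m}"
  have nc: "non_cascading ?C'" using least.prems(1) by (rule non_cascading_subset) auto
  have s1: "(any_step C)\<^sup>*\<^sup>* \<alpha> \<beta>" using least by (blast intro: comm_exhaust_steps)
  have s2: "(any_step C)\<^sup>*\<^sup>* \<beta> \<beta>'"
    using comm_apply_steps[OF least.hyps(5)] by (rule any_steps_mono) auto
  show ?case
  proof (cases "k \<in> ?C'")
    case True
    then show ?thesis using least.IH nc by blast
  next
    case False
    \<comment> \<open>An enabled \<open>k\<close> satisfies \<open>(m, k) \<in> r\<close> because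
      \<open>m\<close> is the least enabled communication; outside \<open>?C'\<close> it can then
      only be \<open>m\<close>.\<close>
    then have "\<not> enabled k \<alpha> \<or> k = m"
      using least by (auto simp: enabled_def)
    then have "\<not> enabled k \<beta>"
      using disabled_steps[OF s1 least.prems] least.hyps(4)
      by (auto simp: enabled_def comm_exhaust_def)
    then show ?thesis using disabled_steps[OF s2 least.prems] by blast
  qed
qed

lemma comm_step_size:
  "comm_step k \<alpha> \<beta> \<Longrightarrow> 2 \<le> length (fst k) \<Longrightarrow> size \<beta> < size \<alpha>"
  by (auto simp: comm_step_iff)

text \<open>A communication with at least two arguments shrinks the multiset, so exhausting it
  terminates. The strict decrease drives the induction in \<open>comm_apply_exists\<close>.\<close>

lemma comm_exhaust_exists:
  assumes "2 \<le> length (fst k)"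
  shows "\<exists>\<beta>. comm_exhaust k \<alpha> \<beta> \<and> size \<beta> \<le> size \<alpha> \<and> (enabled k \<alpha> \<longrightarrow> size \<beta> < size \<alpha>)"
proof (induction "size \<alpha>" arbitrary: \<alpha> rule: less_induct)
  case less
  show ?case
  proof (cases "enabled k \<alpha>")
    case True
    then obtain \<alpha>' where \<alpha>': "comm_step k \<alpha> \<alpha>'" by (auto simp: enabled_def)
    then have lt: "size \<alpha>' < size \<alpha>" using assms by (rule comm_step_size)
    from less[OF lt] obtain \<beta> where "comm_exhaust k \<alpha>' \<beta>" "size \<beta> \<le> size \<alpha>'" by blast
    then have "comm_exhaust k \<alpha> \<beta>" "size \<beta> < size \<alpha>"
      using \<alpha>' lt by (auto simp: comm_exhaust_def intro: converse_rtranclp_into_rtranclp)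
    then show ?thesis by auto
  next
    case False
    then have "comm_exhaust k \<alpha> \<alpha>" by (auto simp: comm_exhaust_def enabled_def)
    then show ?thesis using False by auto
  qed
qed

text \<open>\<open>C\<close> may be infinite, so the induction is on the size of \<alpha>: the
  well-order provides a least enabled communication, and exhausting it makes the multiset strictly
  smaller.\<close>

lemma comm_apply_exists:
  assumes "well_order r" "\<forall>k\<in>C. 2 \<le> length (fst k)"
  shows "\<exists>\<beta>. comm_apply r C \<alpha> \<beta>"
  using assms(2)
proof (induction "size \<alpha>" arbitrary: \<alpha> C rule: less_induct)
  case less
  show ?case
  proof (cases "\<exists>k\<in>C. enabled k \<alpha>")
    case True
    have wf: "wf (r - Id)" and tot: "total r" and refl: "refl r"
      using assms(1)
      by (auto simp: well_order_on_def linear_order_on_def partial_order_on_def preorder_on_def)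
    from True obtain k0 where "k0 \<in> {k \<in> C. enabled k \<alpha>}" by blast
    then obtain k where k: "k \<in> {k \<in> C. enabled k \<alpha>}"
      and mn: "\<And>y. (y, k) \<in> r - Id \<Longrightarrow> y \<notin> {k \<in> C. enabled k \<alpha>}"
      by (rule wfE_min[OF wf]) blast
    then have k: "k \<in> C" "enabled k \<alpha>" by auto
    \<comment> \<open>Minimality for \<open>r - Id\<close> only excludes strict predecessors;
      totality and reflexivity of \<open>r\<close> make \<open>k\<close> the least.\<close>
    have lst: "\<forall>k'\<in>C. (\<exists>\<alpha>'. comm_step k' \<alpha> \<alpha>') \<longrightarrow> (k, k') \<in> r"
    proof (intro ballI impI)
      fix k' assume "k' \<in> C" "\<exists>\<alpha>'. comm_step k' \<alpha> \<alpha>'"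
      then have "(k', k) \<notin> r - Id" using mn[of k'] by (auto simp: enabled_def)
      then show "(k, k') \<in> r" using tot[unfolded total_on_def, rule_format, of k k'] reflD[OF refl, of k] by auto
    qed
    obtain \<beta> where \<beta>: "comm_exhaust k \<alpha> \<beta>" "size \<beta> < size \<alpha>"
      using comm_exhaust_exists[of k \<alpha>] k less.prems by blast
    obtain \<beta>' where "comm_apply r {k' \<in> C. (k, k') \<in> r \<and> k' \<noteq> k} \<beta> \<beta>'"
      using less.hyps[OF \<beta>(2)] less.prems by (metis (no_types, lifting) mem_Collect_eq)
    then show ?thesis using comm_apply.least[OF k(1) _ lst \<beta>(1)] k(2) by (auto simp: enabled_def)
  next
    case False
    then show ?thesis using comm_apply.finished[of C \<alpha> r] by (auto simp: enabled_def)
  qed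
qed


section \<open>Conserved quantities\<close>

text \<open>Grouping parameter lists by name turns the matching of two kinds of arguments into an
  equation between multisets.\<close>

definition params :: "'a aname \<Rightarrow> ('a, 'd) alab multiset \<Rightarrow> 'd dval list multiset" where
  "params n \<alpha> = image_mset snd (filter_mset (\<lambda>l. fst l = n) \<alpha>)"

definition acts :: "('a, 'd) alab multiset \<Rightarrow> ('a, 'd) alab multiset" where
  "acts \<alpha> = filter_mset (\<lambda>l. fst l \<in> range NAct) \<alpha>"

lemma params_simps [simp]:
  "params n {#} = {#}"
  "params n (add_mset (m, ds) \<alpha>) = (if m = n then add_mset ds (params n \<alpha>) else params n \<alpha>)"
  "params n (\<alpha> + \<beta>) = params n \<alpha> + params n \<beta>"
  by (auto simp: params_def)

lemma acts_simps [simp]: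
  "acts {#} = {#}"
  "acts (add_mset (m, ds) \<alpha>) = (if m \<in> range NAct then add_mset (m, ds) (acts \<alpha>) else acts \<alpha>)"
  "acts (\<alpha> + \<beta>) = acts \<alpha> + acts \<beta>"
  by (auto simp: acts_def)

lemma not_action_name [simp]:
  "NCheckP \<notin> range NAct" "NCheckG \<notin> range NAct" "NCheck \<notin> range NAct"
  "NAssignP \<notin> range NAct" "NAssignG \<notin> range NAct" "NAssign \<notin> range NAct" "NValue \<notin> range NAct"
  by auto

lemma count_params: "count (params n \<alpha>) ds = count \<alpha> (n, ds)"
  by (induction \<alpha>) (auto simp: params_def)

lemma count_acts: "count (acts \<alpha>) (n, ds) = (if n \<in> range NAct then count \<alpha> (n, ds) else 0)"
  by (auto simp: acts_def)

text \<open>Action labels are compared through \<open>acts\<close>, the other names one by one.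
  \<open>NCheck\<close> is hidden on the left, so its multiplicity in \<beta> is free and only its
  absence from \<mu> matters.\<close>

lemma visible_eqI:
  fixes \<beta> \<mu> :: "('a, 'd) alab multiset"
  assumes "\<And>ds. count \<beta> (NCheckP, ds) = count \<mu> (NCheckP, ds)"
    "\<And>ds. count \<beta> (NCheckG, ds) = count \<mu> (NCheckG, ds)"
    "\<And>ds. count \<beta> (NAssignP, ds) = count \<mu> (NAssignP, ds)"
    "\<And>ds. count \<beta> (NAssignG, ds) = count \<mu> (NAssignG, ds)"
    "\<And>ds. count \<beta> (NAssign, ds) = count \<mu> (NAssign, ds)"
    "\<And>ds. count \<beta> (NValue, ds) = count \<mu> (NValue, ds)"
    "acts \<beta> = acts \<mu>" "\<And>ds. count \<mu> (NCheck, ds) = 0"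
  shows "filter_mset (\<lambda>l. fst l \<notin> {NCheck}) \<beta> = \<mu>"
proof (rule multiset_eqI)
  fix l :: "('a, 'd) alab"
  obtain n ds where l: "l = (n, ds)" by (cases l)
  have "count \<beta> (NAct a, ds) = count \<mu> (NAct a, ds)" for a
    using arg_cong[OF assms(7), of "\<lambda>x. count x (NAct a, ds)"] by (simp add: count_acts)
  then show "count (filter_mset (\<lambda>l. fst l \<notin> {NCheck}) \<beta>) l = count \<mu> l"
    unfolding l using assms by (cases n) auto
qed

\<comment> \<open>Transitions of prefixes and of \<open>Globs\<close>\<close>
inductive_simps pa_simps:
  "trans_pa \<gamma> E (Alt P Q, V) l s"
  "trans_pa \<gamma> E (Guard v d P, V) l s"
  "trans_pa \<gamma> E (Pre k P, V) l s"
  "trans_pa \<gamma> E (Delta, V) l s"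
  "trans_pa \<gamma> E (PVar X, V) l s"
  "trans_pa \<gamma> E (Par P Q, V) l s"
  "trans_pa \<gamma> E (Encap B P, V) l s"

inductive_simps m_simps:
  "trans_m r S (MPre \<alpha> P) \<mu> R"
  "trans_m r S MDelta \<mu> R"
  "trans_m r S (MAlt P Q) \<mu> R"
  "trans_m r S (MPar P Q) \<mu> R"
  "trans_m r S (MAllow M P) \<mu> R"
  "trans_m r S (MCall N ts) \<mu> R"
  "trans_m r S (MSum x P) \<mu> R"
  "trans_m r S (MHide I P) \<mu> R"
  "trans_m r S (MComm K P) \<mu> R"

text \<open>The contribution of a prefix before communication. It differs from \<open>mlab\<close>
  on assignments, which still wait for an \<open>NAssignG\<close>.\<close>

primrec prelabel :: "('a, 'd) lab \<Rightarrow> ('a, 'd) alab" where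
  "prelabel (Act a) = (NAct a, [])"
| "prelabel (Assign v d) = (NAssignP, [VarV v, DatV d])"

text \<open>\<open>d\<close> is the value that the summation guesses for the global variable,
  \<open>b\<close> the verdict of the collected guards on that guess.\<close>

definition checkP_label :: "'d \<Rightarrow> bool \<Rightarrow> ('a, 'd) alab" where
  "checkP_label d b = (NCheckP, [DatV d, BoolV b])"

primrec update :: "('a, 'd) lab \<Rightarrow> 'd valuation \<Rightarrow> 'd valuation" where
  "update (Act a) V = V"
| "update (Assign v d) V = V(v := d)"

lemma gvar_eq_G: "v = G"
  by (cases v) simp

text \<open>The only data variable is bound by the summation of its own prefix, so the translation
  is closed.\<close>

lemma psubst_chi: "sequential P \<Longrightarrow> psubst \<sigma> (chi P \<epsilon>) = chi P \<epsilon>"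
proof (induction arbitrary: \<sigma> \<epsilon> rule: sequential.induct)
  case (3 P l)
  then show ?case by (cases l) (auto simp: checkP_def)
next
  case (5 l X)
  then show ?case by (cases l) (auto simp: checkP_def)
qed auto

text \<open>The summation admits every guess \<open>d\<close>, right or wrong; only communication
  with \<open>Globs\<close> tests it. The assumption covers the two forms of continuation that
  \<open>sequential\<close> permits.\<close>

lemma chi_pre_trans:
  assumes "sequential P \<or> (\<exists>X. P = PVar X)"
  shows "trans_m r S (chi (Pre l P) \<epsilon>) \<alpha> Q \<longleftrightarrow>
    (\<exists>d. \<alpha> = {#prelabel l, checkP_label d (\<forall>e. e |\<in>| \<epsilon> \<longrightarrow> e = d)#} \<and> Q = chi P {||})"
proof -
  have "psubst \<sigma> (chi P {||}) = chi P {||}" for \<sigma> using assms psubst_chi by auto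
  then show ?thesis
    by (cases l) (auto simp: m_simps checkP_def checkP_label_def)
qed

text \<open>Every \<open>NCheckG\<close> carries the current value and \<open>True\<close>.
  Agreement of parameters with an \<open>NCheckP\<close> therefore forces a correct guess and
  satisfied guards.\<close>

lemma globs_trans:
  "trans_m r (mspec E) (MCall Globs [DVal (DatV d)]) \<alpha> Q \<longleftrightarrow>
    (let g = (NCheckG, [DatV d, BoolV True]); Gl = (\<lambda>d. MCall Globs [DVal (DatV d)]) in
      \<alpha> = {#g#} \<and> Q = Gl d \<or> \<alpha> = {#g, g#} \<and> Q = Gl d \<or>
      (\<exists>e. \<alpha> = {#g, (NAssignG, [VarV G, DatV e])#} \<and> Q = Gl e) \<or>
      \<alpha> = {#(NValue, [VarV G, DatV d])#} \<and> Q = Gl d)"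
  by (auto simp: m_simps globs_body_def Let_def)

section \<open>Communication with \<open>comm_G\<close>: normal forms and invariants\<close>

locale translation =
  fixes \<gamma> :: "'a \<Rightarrow> 'a \<Rightarrow> 'a option"
    and E :: "'x \<Rightarrow> ('a, 'd, 'x) pexpr"
    and C :: "'a communication set"
    and r :: "'a communication rel"
  assumes comm_fun: "communication_function \<gamma>"
    and seq_E: "\<And>X. sequential (E X)"
    and choice: "comm_choice \<gamma> C"
    and wo: "well_order r"
begin

lemma gamma_comm: "\<gamma> a b = \<gamma> b a"
  using comm_fun by (auto simp: communication_function_def)

lemma gamma_stop: "\<gamma> a b = Some c \<Longrightarrow> \<gamma> c d = None" "\<gamma> a b = Some c \<Longrightarrow> \<gamma> d c = None"
  using comm_fun gamma_comm by (auto simp: communication_function_def)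

lemma C_cases:
  assumes "k \<in> C"
  obtains a b c where "k = ([NAct a, NAct b], NAct c)" "\<gamma> a b = Some c"
  using assms choice by (auto simp: comm_choice_def)

lemma C_has:
  assumes "\<gamma> a b = Some c"
  shows "([NAct a, NAct b], NAct c) \<in> C \<or> ([NAct b, NAct a], NAct c) \<in> C"
proof -
  have "\<exists>!k. k \<in> {([NAct a, NAct b], NAct c), ([NAct b, NAct a], NAct c)} \<and> k \<in> C"
    using assms choice by (simp add: comm_choice_def)
  then show ?thesis by (elim ex1E) auto
qed

lemma comm_G_length: "k \<in> comm_G C \<Longrightarrow> length (fst k) = 2"
  by (auto simp: comm_G_def elim: C_cases)

text \<open>A result is \<open>NAssign\<close> or \<open>NCheck\<close>, which are never arguments,
  or a value of \<gamma>, which by \<open>gamma_stop\<close> cannot communicate again.\<close>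

lemma comm_G_non_cascading: "non_cascading (comm_G C)"
proof -
  have "snd k \<notin> set (fst k')" if "k \<in> comm_G C" "k' \<in> comm_G C" for k k'
  proof -
    have *: "snd k \<noteq> NAct a \<and> snd k \<noteq> NAct b" if "\<gamma> a b = Some c" for a b c
    proof -
      have False if "snd k = NAct e" "e = a \<or> e = b" for e
      proof -
        obtain a' b' where "\<gamma> a' b' = Some e"
          using \<open>k \<in> comm_G C\<close> \<open>snd k = NAct e\<close> by (auto simp: comm_G_def elim: C_cases)
        then have "\<gamma> e b = None" "\<gamma> a e = None" by (rule gamma_stop)+
        then show False using \<open>\<gamma> a b = Some c\<close> that(2) by auto
      qed
      then show ?thesis by blast
    qed
    moreover have "snd k \<in> range NAct \<union> {NAssign, NCheck}"
      using that(1) by (auto simp: comm_G_def elim: C_cases)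
    ultimately show ?thesis
      using that(2) unfolding comm_G_def by (auto elim!: C_cases dest: *)
  qed
  then show ?thesis by (auto simp: non_cascading_def)
qed

lemma any_step_cases:
  assumes "any_step (comm_G C) \<alpha> \<beta>"
  obtains (check) \<rho> ds where "\<alpha> = \<rho> + {#(NCheckP, ds), (NCheckG, ds)#}" "\<beta> = add_mset (NCheck, ds) \<rho>"
  | (assign) \<rho> ds where "\<alpha> = \<rho> + {#(NAssignP, ds), (NAssignG, ds)#}" "\<beta> = add_mset (NAssign, ds) \<rho>"
  | (act) \<rho> ds a b c where "\<gamma> a b = Some c" "\<alpha> = \<rho> + {#(NAct a, ds), (NAct b, ds)#}"
      "\<beta> = add_mset (NAct c, ds) \<rho>"
  using assms unfolding any_step_def comm_step_iff comm_G_def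
  by (auto elim!: C_cases)

(* Each communication on checks or assignments turns one argument of either kind into one
   result, so these sums are invariant. *)
definition balance :: "('a, 'd) alab multiset \<Rightarrow> 'd dval list multiset list" where
  "balance \<alpha> =
    [params NCheckP \<alpha> + params NCheck \<alpha>, params NCheckG \<alpha> + params NCheck \<alpha>,
     params NAssignP \<alpha> + params NAssign \<alpha>, params NAssignG \<alpha> + params NAssign \<alpha>,
     params NValue \<alpha>]"

lemma balance_steps: "(any_step (comm_G C))\<^sup>*\<^sup>* \<alpha> \<beta> \<Longrightarrow> balance \<beta> = balance \<alpha>"
proof (induction rule: rtranclp_induct)
  case (step \<beta> \<beta>')
  from step.hyps(2) have "balance \<beta>' = balance \<beta>"
    by (cases rule: any_step_cases) (auto simp: balance_def)
  then show ?case using step.IH by simp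
qed simp

text \<open>Only a communication of actions changes \<open>acts\<close>, and it consumes two action
  labels.\<close>

lemma acts_steps_small:
  fixes \<alpha> \<beta> :: "('a, 'd) alab multiset"
  assumes "(any_step (comm_G C))\<^sup>*\<^sup>* \<alpha> \<beta>" "size (acts \<alpha>) \<le> 1"
  shows "acts \<beta> = acts \<alpha>"
  using assms(1)
proof (induction rule: rtranclp_induct)
  case (step \<beta> \<beta>')
  from step.hyps(2) show ?case
  proof (cases rule: any_step_cases)
    case act
    then have "2 \<le> size (acts \<beta>)" by simp
    then show ?thesis using step.IH assms(2) by simp
  qed (use step.IH in auto)
qed simp

text \<open>The first communication of actions uses up both labels and leaves a single one, too few
  for another.\<close>

lemma acts_steps_pair:
  fixes \<alpha> \<beta> :: "('a, 'd) alab multiset"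
  assumes "(any_step (comm_G C))\<^sup>*\<^sup>* \<alpha> \<beta>" "acts \<alpha> = {#(NAct a, ds), (NAct b, ds)#}"
  shows "acts \<beta> = acts \<alpha> \<or> (\<exists>c. \<gamma> a b = Some c \<and> acts \<beta> = {#(NAct c, ds)#})"
  using assms(1)
proof (induction rule: rtranclp_induct)
  case (step \<beta> \<beta>')
  from step.hyps(2) show ?case
  proof (cases rule: any_step_cases)
    case (act \<rho> ds' a' b' c)
    then have "size (acts \<beta>) \<ge> 2" by simp
    then have *: "acts \<beta> = {#(NAct a, ds), (NAct b, ds)#}" using step.IH assms(2) by auto
    \<comment> \<open>The consumed pair is the given one up to order, so commutativity of \<gamma>
      identifies the result.\<close>
    then have "acts \<rho> = {#} \<and> ds' = ds \<and> (a' = a \<and> b' = b \<or> a' = b \<and> b' = a)"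
      unfolding act(2) by (auto simp: add_eq_conv_ex)
    then show ?thesis using act gamma_comm by auto
  qed (use step.IH in auto)
qed simp

lemma disabled_pair:
  assumes "\<not> enabled ([m, n], c) \<beta>" "m \<noteq> n"
  shows "params m \<beta> \<inter># params n \<beta> = {#}"
proof -
  have "count \<beta> (m, ds) = 0 \<or> count \<beta> (n, ds) = 0" for ds
  proof (rule ccontr)
    assume "\<not> ?thesis"
    then have "{#(m, ds), (n, ds)#} \<subseteq># \<beta>"
      using assms(2) by (auto simp: subseteq_mset_def Suc_le_eq)
    then show False using assms(1) by (auto simp: enabled_iff)
  qed
  then show ?thesis by (intro multiset_eqI) (metis count_empty count_params min_0L min_0R count_inter_mset)
qed

text \<open>By the invariant, both kinds of arguments still occur with the same parameters in
  \<beta>; in a normal form they have no parameters in common. Multisets that are equal and disjoint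
  are empty, and the invariant then locates all assignments in \<open>NAssign\<close>.\<close>

lemma comm_balanced:
  fixes \<alpha> \<beta> :: "('a, 'd) alab multiset"
  assumes ap: "comm_apply r (comm_G C) \<alpha> \<beta>"
    and "params NCheck \<alpha> = {#}" "params NAssign \<alpha> = {#}"
    and "params NCheckP \<alpha> = params NCheckG \<alpha>" "params NAssignP \<alpha> = params NAssignG \<alpha>"
  shows "params NCheckP \<beta> = {#}" "params NCheckG \<beta> = {#}"
    "params NAssignP \<beta> = {#}" "params NAssignG \<beta> = {#}"
    "params NAssign \<beta> = params NAssignP \<alpha>" "params NValue \<beta> = params NValue \<alpha>"
proof -
  have bal: "balance \<beta> = balance \<alpha>" using comm_apply_steps[OF ap] by (rule balance_steps)
  have "\<not> enabled ([NCheckP, NCheckG], NCheck) \<beta>" "\<not> enabled ([NAssignP, NAssignG], NAssign) \<beta>"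
    using comm_apply_normal[OF ap comm_G_non_cascading] by (auto simp: comm_G_def)
  then have "params NCheckP \<beta> \<inter># params NCheckG \<beta> = {#}" "params NAssignP \<beta> \<inter># params NAssignG \<beta> = {#}"
    by (auto dest: disabled_pair)
  moreover have "params NCheckP \<beta> = params NCheckG \<beta>" "params NAssignP \<beta> = params NAssignG \<beta>"
    using bal assms by (auto simp: balance_def) (metis add_right_imp_eq)+
  ultimately show "params NCheckP \<beta> = {#}" "params NCheckG \<beta> = {#}"
    "params NAssignP \<beta> = {#}" "params NAssignG \<beta> = {#}" by auto
  then show "params NAssign \<beta> = params NAssignP \<alpha>" "params NValue \<beta> = params NValue \<alpha>"
    using bal assms by (auto simp: balance_def)
qed

text \<open>Serves to construct transitions: some result exists, and its visible part is determined
  by counting. The actions are left to a premise about all results, because one action and two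
  synchronising actions need different arguments.\<close>

lemma comm_result:
  fixes \<alpha> \<mu> :: "('a, 'd) alab multiset"
  assumes "params NCheck \<alpha> = {#}" "params NAssign \<alpha> = {#}"
    and "params NCheckP \<alpha> = params NCheckG \<alpha>" "params NAssignP \<alpha> = params NAssignG \<alpha>"
    and "\<And>\<beta>. comm_apply r (comm_G C) \<alpha> \<beta> \<Longrightarrow> acts \<beta> = acts \<mu>"
    and "params NCheckP \<mu> = {#}" "params NCheckG \<mu> = {#}" "params NCheck \<mu> = {#}"
    and "params NAssignP \<mu> = {#}" "params NAssignG \<mu> = {#}"
    and "params NAssign \<mu> = params NAssignP \<alpha>" "params NValue \<mu> = params NValue \<alpha>"
  shows "\<exists>\<beta>. comm_apply r (comm_G C) \<alpha> \<beta> \<and> filter_mset (\<lambda>l. fst l \<notin> {NCheck}) \<beta> = \<mu>"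
proof -
  obtain \<beta> where \<beta>: "comm_apply r (comm_G C) \<alpha> \<beta>"
    using comm_apply_exists[OF wo, of "comm_G C" \<alpha>] comm_G_length by auto
  have "filter_mset (\<lambda>l. fst l \<notin> {NCheck}) \<beta> = \<mu>"
    by (rule visible_eqI; simp flip: count_params add: comm_balanced[OF \<beta> assms(1-4)] assms(5)[OF \<beta>] assms(6-))
  with \<beta> show ?thesis by blast
qed

text \<open>The invariant read backwards: an allowed visible label leaves no argument of a check or
  an assignment unmatched, so both kinds agreed in \<alpha> from the start.\<close>

lemma comm_visible_balance:
  fixes \<alpha> \<beta> :: "('a, 'd) alab multiset"
  assumes ap: "comm_apply r (comm_G C) \<alpha> \<beta>"
    and vis: "filter_mset (\<lambda>l. fst l \<notin> {NCheck}) \<beta> = {#(n, ds)#}"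
    and n: "n \<in> allowed B"
    and 0: "params NCheck \<alpha> = {#}" "params NAssign \<alpha> = {#}"
  shows "params NCheckP \<alpha> = params NCheckG \<alpha>" "params NAssignP \<alpha> = params NAssignG \<alpha>"
    "params NAssignP \<alpha> = params NAssign {#(n, ds)#}" "params NValue \<alpha> = params NValue {#(n, ds)#}"
    "acts \<beta> = acts {#(n, ds)#}"
proof -
  have bal: "balance \<beta> = balance \<alpha>" using comm_apply_steps[OF ap] by (rule balance_steps)
  have p: "params m \<beta> = params m {#(n, ds)#}" if "m \<noteq> NCheck" for m
    unfolding vis[symmetric] params_def using that
    by (auto simp: filter_filter_mset intro!: arg_cong[of _ _ "image_mset snd"] filter_mset_cong)
  have nn: "n \<noteq> NCheckP" "n \<noteq> NCheckG" "n \<noteq> NAssignP" "n \<noteq> NAssignG"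
    using n by (auto simp: allowed_def)
  show "params NCheckP \<alpha> = params NCheckG \<alpha>" "params NAssignP \<alpha> = params NAssignG \<alpha>"
    "params NAssignP \<alpha> = params NAssign {#(n, ds)#}" "params NValue \<alpha> = params NValue {#(n, ds)#}"
    using bal 0 nn p by (auto simp: balance_def)
  show "acts \<beta> = acts {#(n, ds)#}"
    unfolding vis[symmetric] acts_def
    by (auto simp: filter_filter_mset intro!: filter_mset_cong)
qed

section \<open>Shapes of the transitions of a translated expression\<close>

lemma pre_trans: "trans_pa \<gamma> E (Pre l P, V) l' s \<longleftrightarrow> l' = l \<and> s = (P, update l V)"
  by (cases l) (auto simp: pa_simps)

text \<open>A source transition is promised only when the guess is correct and the guards hold; all
  other transitions of this shape are blocked later by \<open>Globs\<close>.\<close>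

definition alone ::
  "('a, 'd, 'x) pexpr \<Rightarrow> 'd fset \<Rightarrow> ('a, 'd) alab multiset \<Rightarrow> ('a, 'd, 'x) mproc \<Rightarrow> bool" where
  "alone P \<epsilon> \<alpha> Q \<longleftrightarrow> (\<exists>l d b P'. \<alpha> = {#prelabel l, checkP_label d b#} \<and> Q = chi P' {||} \<and>
    par_sequential P' \<and> (b \<longrightarrow> (\<forall>e. e |\<in>| \<epsilon> \<longrightarrow> e = d) \<and>
      (\<forall>V. V G = d \<longrightarrow> trans_pa \<gamma> E (P, V) l (P', update l V))))"

(* Nothing is claimed when a label is an assignment: two simultaneous assignments, or an
   assignment next to an action, are blocked because two checkG leave no room for assignG. *)
definition paired ::
  "('a, 'd, 'x) pexpr \<Rightarrow> ('a, 'd) alab multiset \<Rightarrow> ('a, 'd, 'x) mproc \<Rightarrow> bool" where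
  "paired P \<alpha> Q \<longleftrightarrow> (\<exists>l1 d1 b1 l2 d2 b2 P'.
    \<alpha> = {#prelabel l1, checkP_label d1 b1, prelabel l2, checkP_label d2 b2#} \<and>
    Q = chi P' {||} \<and> par_sequential P' \<and>
    (\<forall>a1 a2 c V. l1 = Act a1 \<longrightarrow> l2 = Act a2 \<longrightarrow> \<gamma> a1 a2 = Some c \<longrightarrow> b1 \<longrightarrow> b2 \<longrightarrow>
      V G = d1 \<longrightarrow> V G = d2 \<longrightarrow> trans_pa \<gamma> E (P, V) (Act c) (P', V)))"

(* Each participant contributes exactly one checkP. *)
definition participants :: "('a, 'd) alab multiset \<Rightarrow> nat \<Rightarrow> bool" where
  "participants \<alpha> n \<longleftrightarrow> size (params NCheckP \<alpha>) = n \<and> params NCheckG \<alpha> = {#} \<and>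
    params NCheck \<alpha> = {#} \<and> params NAssignG \<alpha> = {#} \<and> params NAssign \<alpha> = {#} \<and>
    params NValue \<alpha> = {#}"

lemma participants_prelabel [simp]: "participants {#prelabel l, checkP_label d b#} (Suc 0)"
  by (cases l) (auto simp: participants_def checkP_label_def)

lemma participants_add:
  "participants \<alpha> m \<Longrightarrow> participants \<beta> n \<Longrightarrow> participants (\<alpha> + \<beta>) (m + n)"
  by (auto simp: participants_def)

lemma alone_participants: "alone P \<epsilon> \<alpha> Q \<Longrightarrow> participants \<alpha> 1"
  by (auto simp: alone_def)

lemma paired_participants: "paired P \<alpha> Q \<Longrightarrow> participants \<alpha> 2"
  using participants_add[OF participants_prelabel participants_prelabel]
  by (auto simp: paired_def numeral_2_eq_2)

text \<open>Treats choice, guards and recursion uniformly. Guards dropped from \<epsilon> remain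
  available as an assumption when the transition is lifted from \<open>P\<close> to
  \<open>R\<close>.\<close>

lemma alone_mono:
  assumes "alone P \<epsilon> \<alpha> Q" "\<And>e. e |\<in>| \<epsilon>' \<Longrightarrow> e |\<in>| \<epsilon>"
    and "\<And>V l P' V'. (\<And>e. e |\<in>| \<epsilon> \<Longrightarrow> e = V G) \<Longrightarrow>
      trans_pa \<gamma> E (P, V) l (P', V') \<Longrightarrow> trans_pa \<gamma> E (R, V) l (P', V')"
  shows "alone R \<epsilon>' \<alpha> Q"
proof -
  obtain l d b P' where *: "\<alpha> = {#prelabel l, checkP_label d b#}" "Q = chi P' {||}" "par_sequential P'"
    and b: "b \<Longrightarrow> (\<forall>e. e |\<in>| \<epsilon> \<longrightarrow> e = d) \<and>
      (\<forall>V. V G = d \<longrightarrow> trans_pa \<gamma> E (P, V) l (P', update l V))"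
    using assms(1) unfolding alone_def by blast
  have "(\<forall>e. e |\<in>| \<epsilon>' \<longrightarrow> e = d) \<and> (\<forall>V. V G = d \<longrightarrow> trans_pa \<gamma> E (R, V) l (P', update l V))" if b
    using b[OF that] assms(2,3) by simp
  then show ?thesis using * unfolding alone_def by blast
qed

lemma alone_pre:
  assumes "sequential P \<or> (\<exists>X. P = PVar X)" "trans_m r S (chi (Pre l P) \<epsilon>) \<alpha> Q"
  shows "alone (Pre l P) \<epsilon> \<alpha> Q"
proof -
  have "par_sequential P" using assms(1) by (auto intro: par_sequential.intros)
  then show ?thesis
    using assms(2) unfolding chi_pre_trans[OF assms(1)] alone_def pre_trans by blast
qed

lemma alone_chi_sequential:
  assumes "sequential P" "trans_m r (mspec E) (chi P \<epsilon>) \<alpha> Q"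
  shows "alone P \<epsilon> \<alpha> Q"
  using assms
proof (induction arbitrary: \<alpha> Q \<epsilon> rule: sequential.induct)
  case (1 P\<^sub>1 P\<^sub>2)
  then have "alone P\<^sub>1 \<epsilon> \<alpha> Q \<or> alone P\<^sub>2 \<epsilon> \<alpha> Q" by (auto simp: m_simps)
  then show ?case
    by (auto elim!: alone_mono intro: trans_pa.alt_left trans_pa.alt_right)
next
  case (2 P v d)
  then have "alone P (finsert d \<epsilon>) \<alpha> Q" by simp
  \<comment> \<open>The value \<open>d\<close> leaves the set of pending guards and becomes the side
    condition of the source rule.\<close>
  then show ?case
    by (rule alone_mono) (auto simp: gvar_eq_G[of v] intro!: trans_pa.guard)
next
  case (3 P l)
  then show ?case by (blast intro: alone_pre)
next
  case 4
  then show ?case by (auto simp: m_simps)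
next
  case (5 l X)
  then show ?case by (blast intro: alone_pre)
qed

lemma alone_par_left:
  assumes "alone P {||} \<alpha> Q" "par_sequential R"
  shows "alone (Par P R) {||} \<alpha> (MPar Q (chi R {||}))"
proof -
  obtain l d b P' where *: "\<alpha> = {#prelabel l, checkP_label d b#}" "Q = chi P' {||}" "par_sequential P'"
    "\<And>V. b \<Longrightarrow> V G = d \<Longrightarrow> trans_pa \<gamma> E (P, V) l (P', update l V)"
    using assms by (auto simp: alone_def)
  then show ?thesis using assms(2) unfolding alone_def
    by (intro exI[of _ l] exI[of _ d] exI[of _ b] exI[of _ "Par P' R"])
      (auto intro: trans_pa.par_left par_sequential.intros)
qed

lemma alone_par_right:
  assumes "alone P {||} \<alpha> Q" "par_sequential R"
  shows "alone (Par R P) {||} \<alpha> (MPar (chi R {||}) Q)"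
proof -
  obtain l d b P' where *: "\<alpha> = {#prelabel l, checkP_label d b#}" "Q = chi P' {||}" "par_sequential P'"
    "\<And>V. b \<Longrightarrow> V G = d \<Longrightarrow> trans_pa \<gamma> E (P, V) l (P', update l V)"
    using assms by (auto simp: alone_def)
  then show ?thesis using assms(2) unfolding alone_def
    by (intro exI[of _ l] exI[of _ d] exI[of _ b] exI[of _ "Par R P'"])
      (auto intro: trans_pa.par_right par_sequential.intros)
qed

lemma paired_par_left:
  assumes "paired P \<alpha> Q" "par_sequential R"
  shows "paired (Par P R) \<alpha> (MPar Q (chi R {||}))"
proof -
  obtain l1 d1 b1 l2 d2 b2 P' where *:
    "\<alpha> = {#prelabel l1, checkP_label d1 b1, prelabel l2, checkP_label d2 b2#}"
    "Q = chi P' {||}" "par_sequential P'"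
    "\<And>a1 a2 c V. l1 = Act a1 \<Longrightarrow> l2 = Act a2 \<Longrightarrow> \<gamma> a1 a2 = Some c \<Longrightarrow> b1 \<Longrightarrow> b2 \<Longrightarrow>
      V G = d1 \<Longrightarrow> V G = d2 \<Longrightarrow> trans_pa \<gamma> E (P, V) (Act c) (P', V)"
    using assms(1) unfolding paired_def by blast
  show ?thesis using * assms(2) unfolding paired_def
    by (intro exI[of _ l1] exI[of _ d1] exI[of _ b1] exI[of _ l2] exI[of _ d2] exI[of _ b2]
        exI[of _ "Par P' R"]) (auto intro!: trans_pa.par_left par_sequential.intros(1))
qed

lemma paired_par_right:
  assumes "paired P \<alpha> Q" "par_sequential R"
  shows "paired (Par R P) \<alpha> (MPar (chi R {||}) Q)"
proof -
  obtain l1 d1 b1 l2 d2 b2 P' where *: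
    "\<alpha> = {#prelabel l1, checkP_label d1 b1, prelabel l2, checkP_label d2 b2#}"
    "Q = chi P' {||}" "par_sequential P'"
    "\<And>a1 a2 c V. l1 = Act a1 \<Longrightarrow> l2 = Act a2 \<Longrightarrow> \<gamma> a1 a2 = Some c \<Longrightarrow> b1 \<Longrightarrow> b2 \<Longrightarrow>
      V G = d1 \<Longrightarrow> V G = d2 \<Longrightarrow> trans_pa \<gamma> E (P, V) (Act c) (P', V)"
    using assms(1) unfolding paired_def by blast
  show ?thesis using * assms(2) unfolding paired_def
    by (intro exI[of _ l1] exI[of _ d1] exI[of _ b1] exI[of _ l2] exI[of _ d2] exI[of _ b2]
        exI[of _ "Par R P'"]) (auto intro!: trans_pa.par_right par_sequential.intros(1))
qed

lemma paired_par_both: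
  assumes "alone P {||} \<alpha> Q" "alone R {||} \<beta> S"
  shows "paired (Par P R) (\<alpha> + \<beta>) (MPar Q S)"
proof -
  obtain l1 d1 b1 P' where 1: "\<alpha> = {#prelabel l1, checkP_label d1 b1#}" "Q = chi P' {||}"
    "par_sequential P'" "\<And>V. b1 \<Longrightarrow> V G = d1 \<Longrightarrow> trans_pa \<gamma> E (P, V) l1 (P', update l1 V)"
    using assms by (auto simp: alone_def)
  obtain l2 d2 b2 R' where 2: "\<beta> = {#prelabel l2, checkP_label d2 b2#}" "S = chi R' {||}"
    "par_sequential R'" "\<And>V. b2 \<Longrightarrow> V G = d2 \<Longrightarrow> trans_pa \<gamma> E (R, V) l2 (R', update l2 V)"
    using assms by (auto simp: alone_def)
  have "trans_pa \<gamma> E (Par P R, V) (Act c) (Par P' R', V)"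
    if "l1 = Act a1" "l2 = Act a2" "\<gamma> a1 a2 = Some c" b1 b2 "V G = d1" "V G = d2" for a1 a2 c V
    \<comment> \<open>On actions \<open>update\<close> is the identity, so both premises keep
      \<open>V\<close>, as the synchronisation rule demands.\<close>
    using 1(4)[of V] 2(4)[of V] that by (auto intro: trans_pa.comm)
  then show ?thesis using 1(1-3) 2(1-3) unfolding paired_def
    by (intro exI[of _ l1] exI[of _ d1] exI[of _ b1] exI[of _ l2] exI[of _ d2] exI[of _ b2]
        exI[of _ "Par P' R'"]) (auto intro: par_sequential.intros(1))
qed

text \<open>Participants of the two sides of a parallel composition add up, and only one plus one
  gives a pair. Of three or more, the number alone suffices to exclude the transition later.\<close>

lemma chi_transD:
  assumes "par_sequential P" "trans_m r (mspec E) (chi P {||}) \<alpha> Q"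
  obtains (alone) "alone P {||} \<alpha> Q" | (paired) "paired P \<alpha> Q"
  | (crowd) n where "3 \<le> n" "participants \<alpha> n"
proof -
  have "alone P {||} \<alpha> Q \<or> paired P \<alpha> Q \<or> (\<exists>n\<ge>3. participants \<alpha> n)"
    using assms
  proof (induction arbitrary: \<alpha> Q rule: par_sequential.induct)
    case (1 P R)
    \<comment> \<open>Every transition has at least one participant, and two unless it is of the
      shape \<open>alone\<close>.\<close>
    have ex: "\<exists>n. participants \<alpha> n \<and> 1 \<le> n \<and> (alone P {||} \<alpha> Q \<or> 2 \<le> n)"
      if "alone P {||} \<alpha> Q \<or> paired P \<alpha> Q \<or> (\<exists>n\<ge>3. participants \<alpha> n)" for P \<alpha> Q
      using that by (auto dest: alone_participants paired_participants)
    from "1.prems" consider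
      (left) P' where "trans_m r (mspec E) (chi P {||}) \<alpha> P'" "Q = MPar P' (chi R {||})"
    | (right) R' where "trans_m r (mspec E) (chi R {||}) \<alpha> R'" "Q = MPar (chi P {||}) R'"
    | (both) \<alpha>1 \<alpha>2 P' R' where "trans_m r (mspec E) (chi P {||}) \<alpha>1 P'"
        "trans_m r (mspec E) (chi R {||}) \<alpha>2 R'" "\<alpha> = \<alpha>1 + \<alpha>2" "Q = MPar P' R'"
      by (auto simp: m_simps)
    then show ?case
    proof cases
      case left
      then show ?thesis using "1.IH"(1) "1.hyps"(2) by (blast intro: alone_par_left paired_par_left)
    next
      case right
      then show ?thesis using "1.IH"(2) "1.hyps"(1) by (blast intro: alone_par_right paired_par_right)
    next
      case both
      obtain m where m: "participants \<alpha>1 m" "1 \<le> m" "alone P {||} \<alpha>1 P' \<or> 2 \<le> m"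
        using ex[OF "1.IH"(1)[OF both(1)]] by blast
      obtain n where n: "participants \<alpha>2 n" "1 \<le> n" "alone R {||} \<alpha>2 R' \<or> 2 \<le> n"
        using ex[OF "1.IH"(2)[OF both(2)]] by blast
      have "participants \<alpha> (m + n)" using m n both(3) by (simp add: participants_add)
      then show ?thesis using m n both paired_par_both by fastforce
    qed
  next
    case (2 X)
    then have "alone (E X) {||} \<alpha> Q"
      using alone_chi_sequential[OF seq_E] by (auto simp: m_simps psubst_chi[OF seq_E])
    then have "alone (PVar X) {||} \<alpha> Q"
      by (rule alone_mono) (auto intro: trans_pa.rec)
    then show ?case by blast
  next
    case (3 P)
    then show ?case using alone_chi_sequential by blast
  qed
  then show thesis using that by blast
qed

section \<open>Source transitions reproduced by \<open>chi\<close>\<close>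

lemma sequential_transD:
  assumes "sequential P" "trans_pa \<gamma> E (P, V) l s" "\<And>e. e |\<in>| \<epsilon> \<Longrightarrow> e = V G"
  shows "\<exists>P'. s = (P', update l V) \<and> par_sequential P' \<and>
    trans_m r (mspec E) (chi P \<epsilon>) {#prelabel l, checkP_label (V G) True#} (chi P' {||})"
  using assms
proof (induction arbitrary: \<epsilon> rule: sequential.induct)
  case (1 P Q)
  then show ?case by (fastforce simp: pa_simps m_simps)
next
  case (2 P v d)
  \<comment> \<open>The guard just passed gives \<open>d = V G\<close>, so all pending guards in
    \<open>finsert d \<epsilon>\<close> hold for the correct guess.\<close>
  then have "\<exists>P'. s = (P', update l V) \<and> par_sequential P' \<and>
    trans_m r (mspec E) (chi P (finsert d \<epsilon>)) {#prelabel l, checkP_label (V G) True#} (chi P' {||})"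
    by (intro "2.IH") (auto simp: pa_simps gvar_eq_G[of v])
  then show ?case by simp
next
  case (3 P k)
  then show ?case by (auto simp: pre_trans chi_pre_trans intro!: par_sequential.intros exI[of _ "V G"])
next
  case 4
  then show ?case by (auto simp: pa_simps)
next
  case (5 k X)
  then show ?case by (auto simp: pre_trans chi_pre_trans intro!: par_sequential.intros exI[of _ "V G"])
qed

text \<open>Before communication a synchronisation shows its two actions and not yet their result
  \<open>c\<close>, so it needs a multiset of its own.\<close>

definition joint :: "('a, 'd, 'x) pexpr \<Rightarrow> 'd \<Rightarrow> 'a \<Rightarrow> ('a, 'd, 'x) pexpr \<Rightarrow> bool" where
  "joint P d c P' \<longleftrightarrow> (\<exists>a b. \<gamma> a b = Some c \<and> trans_m r (mspec E) (chi P {||})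
    {#prelabel (Act a), checkP_label d True, prelabel (Act b), checkP_label d True#} (chi P' {||}))"

lemma joint_stop: "joint P d c P' \<Longrightarrow> \<gamma> c e = None \<and> \<gamma> e c = None"
  unfolding joint_def using gamma_stop by blast

lemma par_sequential_transD:
  assumes "par_sequential P" "trans_pa \<gamma> E (P, V) l s"
  shows "\<exists>P'. s = (P', update l V) \<and> par_sequential P' \<and>
    (trans_m r (mspec E) (chi P {||}) {#prelabel l, checkP_label (V G) True#} (chi P' {||}) \<or>
     (\<exists>c. l = Act c \<and> joint P (V G) c P'))"
  using assms
proof (induction arbitrary: l s rule: par_sequential.induct)
  case (1 P Q)
  from "1.prems" consider
    (left) P' V' where "trans_pa \<gamma> E (P, V) l (P', V')" "s = (Par P' Q, V')"
  | (right) Q' V' where "trans_pa \<gamma> E (Q, V) l (Q', V')" "s = (Par P Q', V')"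
  | (comm) a b c P' Q' where "trans_pa \<gamma> E (P, V) (Act a) (P', V)"
      "trans_pa \<gamma> E (Q, V) (Act b) (Q', V)" "\<gamma> a b = Some c" "l = Act c" "s = (Par P' Q', V)"
    by (auto simp: pa_simps)
  then show ?case
  proof cases
    case left
    from "1.IH"(1)[OF left(1)] left(2) "1.hyps"(2) show ?thesis
      by (auto simp: joint_def intro!: par_sequential.intros(1) trans_m.par_left)
  next
    case right
    from "1.IH"(2)[OF right(1)] right(2) "1.hyps"(1) show ?thesis
      by (auto simp: joint_def intro!: par_sequential.intros(1) trans_m.par_right)
  next
    case comm
    \<comment> \<open>Were \<open>a\<close> itself the result of a synchronisation,
      \<open>joint_stop\<close> would make \<gamma> undefined on \<open>a\<close> and
      \<open>b\<close>; hence each partner acts alone.\<close>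
    have "trans_m r (mspec E) (chi P {||}) {#prelabel (Act a), checkP_label (V G) True#} (chi P' {||})"
      "par_sequential P'"
      using "1.IH"(1)[OF comm(1)] comm(3) joint_stop[of P "V G" a P' b] by auto
    moreover have "trans_m r (mspec E) (chi Q {||}) {#prelabel (Act b), checkP_label (V G) True#} (chi Q' {||})"
      "par_sequential Q'"
      using "1.IH"(2)[OF comm(2)] comm(3) joint_stop[of Q "V G" b Q' a] by auto
    ultimately show ?thesis using comm(3-5) trans_m.par_both
      by (fastforce simp: joint_def intro: par_sequential.intros(1))
  qed
next
  case (2 X)
  then show ?case
    using sequential_transD[OF seq_E, of X V l s "{||}"]
    by (auto simp: pa_simps m_simps psubst_chi[OF seq_E])
next
  case (3 P)
  then show ?case using sequential_transD[of P V l s "{||}"] by auto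
qed


section \<open>Transitions of the translated process\<close>

definition inner :: "('a, 'd, 'x) pexpr \<Rightarrow> 'd \<Rightarrow> ('a, 'd, 'x) mproc" where
  "inner P d = MPar (chi P {||}) (MCall Globs [DVal (DatV d)])"

text \<open>The allow operator sees only names; a single name comes from a single label, whose
  parameters are recovered here.\<close>

lemma Psi_trans:
  "trans_m r (mspec E) (Psi C B P V) \<mu> Q \<longleftrightarrow>
    (\<exists>\<alpha> \<beta> R n ds. trans_m r (mspec E) (inner P (V G)) \<alpha> R \<and> comm_apply r (comm_G C) \<alpha> \<beta> \<and>
      filter_mset (\<lambda>l. fst l \<notin> {NCheck}) \<beta> = {#(n, ds)#} \<and> \<mu> = {#(n, ds)#} \<and> n \<in> allowed B \<and>
      Q = MAllow ((\<lambda>n. {#n#}) ` allowed B) (MHide {NCheck} (MComm (comm_G C) R)))"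
  (is "?L \<longleftrightarrow> ?R")
proof
  assume ?L
  then obtain \<alpha> \<beta> R n where *: "trans_m r (mspec E) (inner P (V G)) \<alpha> R"
    "comm_apply r (comm_G C) \<alpha> \<beta>" "\<mu> = filter_mset (\<lambda>l. fst l \<notin> {NCheck}) \<beta>"
    "image_mset fst \<mu> = {#n#}" "n \<in> allowed B"
    "Q = MAllow ((\<lambda>n. {#n#}) ` allowed B) (MHide {NCheck} (MComm (comm_G C) R))"
    unfolding Psi_def inner_def[symmetric] m_simps(5,8,9) by blast
  have "size \<mu> = 1" using arg_cong[OF *(4), of size] by simp
  then obtain l where "\<mu> = {#l#}" using size_1_singleton_mset by blast
  then obtain ds where "\<mu> = {#(n, ds)#}" using *(4) by (cases l) auto
  with * show ?R by metis
next
  assume ?R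
  then obtain \<alpha> \<beta> R n ds where *: "trans_m r (mspec E) (inner P (V G)) \<alpha> R"
    "comm_apply r (comm_G C) \<alpha> \<beta>" "filter_mset (\<lambda>l. fst l \<notin> {NCheck}) \<beta> = {#(n, ds)#}"
    "\<mu> = {#(n, ds)#}" "n \<in> allowed B"
    "Q = MAllow ((\<lambda>n. {#n#}) ` allowed B) (MHide {NCheck} (MComm (comm_G C) R))"
    by blast
  show ?L
    unfolding Psi_def inner_def[symmetric] *(6)
  proof (rule trans_m.allow)
    show "trans_m r (mspec E) (MHide {NCheck} (MComm (comm_G C) (inner P (V G)))) \<mu>
      (MHide {NCheck} (MComm (comm_G C) R))"
      using trans_m.hide[OF trans_m.comm[OF *(1,2)], of "{NCheck}"] unfolding *(3,4) .
  qed (use *(4,5) in auto)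
qed

lemma Psi_unfold:
  "Psi C B P V = MAllow ((\<lambda>n. {#n#}) ` allowed B) (MHide {NCheck} (MComm (comm_G C) (inner P (V G))))"
  by (simp add: Psi_def inner_def)

lemma Psi_transI:
  assumes "trans_m r (mspec E) (inner P (V G)) \<alpha> (inner P' (V' G))"
    and "\<exists>\<beta>. comm_apply r (comm_G C) \<alpha> \<beta> \<and> filter_mset (\<lambda>l. fst l \<notin> {NCheck}) \<beta> = \<mu>"
    and "\<mu> = {#(n, ds)#}" "n \<in> allowed B"
  shows "trans_m r (mspec E) (Psi C B P V) \<mu> (Psi C B P' V')"
  unfolding Psi_trans using assms Psi_unfold[of B P' V'] by blast

lemma Psi_trans_value:
  "trans_m r (mspec E) (Psi C B P V) {#(NValue, [VarV G, DatV (V G)])#} (Psi C B P V)"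
proof -
  let ?\<mu> = "{#(NValue, [VarV G, DatV (V G)])#} :: ('a, 'd) alab multiset"
  have "trans_m r (mspec E) (inner P (V G)) ?\<mu> (inner P (V G))"
    unfolding inner_def by (rule trans_m.par_right) (auto simp: globs_trans Let_def)
  moreover have "\<exists>\<beta>. comm_apply r (comm_G C) ?\<mu> \<beta> \<and> filter_mset (\<lambda>l. fst l \<notin> {NCheck}) \<beta> = ?\<mu>"
    by (rule comm_result) (auto dest!: comm_apply_steps acts_steps_small)
  ultimately show ?thesis
    by (rule Psi_transI) (auto simp: allowed_def)
qed

text \<open>\<open>Globs\<close> answers with what the label requires: one check for an action, a
  check and the new value for an assignment, two checks for a synchronisation.\<close>

lemma Psi_trans_lab:
  assumes "par_sequential P" "trans_pa \<gamma> E (P, V) l s" "l \<notin> Act ` B"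
  shows "\<exists>P'. s = (P', update l V) \<and> par_sequential P' \<and>
    trans_m r (mspec E) (Psi C B P V) (mlab l) (Psi C B P' (update l V))"
proof -
  let ?g = "(NCheckG, [DatV (V G), BoolV True]) :: ('a, 'd) alab"
  obtain P' where P': "s = (P', update l V)" "par_sequential P'" and tr:
    "trans_m r (mspec E) (chi P {||}) {#prelabel l, checkP_label (V G) True#} (chi P' {||}) \<or>
     (\<exists>c. l = Act c \<and> joint P (V G) c P')"
    using par_sequential_transD[OF assms(1,2)] by blast
  have "\<exists>\<alpha>. trans_m r (mspec E) (inner P (V G)) \<alpha> (inner P' (update l V G)) \<and>
    (\<exists>\<beta>. comm_apply r (comm_G C) \<alpha> \<beta> \<and> filter_mset (\<lambda>l. fst l \<notin> {NCheck}) \<beta> = mlab l)"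
    using tr
  proof (elim disjE exE conjE)
    assume t: "trans_m r (mspec E) (chi P {||}) {#prelabel l, checkP_label (V G) True#} (chi P' {||})"
    show ?thesis
    proof (cases l)
      case (Act a)
      let ?\<alpha> = "{#prelabel l, checkP_label (V G) True#} + {#?g#}"
      have "trans_m r (mspec E) (inner P (V G)) ?\<alpha> (inner P' (update l V G))"
        unfolding inner_def by (rule trans_m.par_both[OF t]) (auto simp: globs_trans Let_def Act)
      moreover have "\<exists>\<beta>. comm_apply r (comm_G C) ?\<alpha> \<beta> \<and>
          filter_mset (\<lambda>l. fst l \<notin> {NCheck}) \<beta> = mlab l"
        by (rule comm_result)
          (auto dest!: comm_apply_steps acts_steps_small simp: Act checkP_label_def)
      ultimately show ?thesis by blast
    next
      case (Assign v d)
      let ?\<alpha> = "{#prelabel l, checkP_label (V G) True#} + {#?g, (NAssignG, [VarV G, DatV d])#}"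
      have "trans_m r (mspec E) (inner P (V G)) ?\<alpha> (inner P' (update l V G))"
        unfolding inner_def
        by (rule trans_m.par_both[OF t]) (auto simp: globs_trans Let_def Assign gvar_eq_G[of v])
      moreover have "\<exists>\<beta>. comm_apply r (comm_G C) ?\<alpha> \<beta> \<and>
          filter_mset (\<lambda>l. fst l \<notin> {NCheck}) \<beta> = mlab l"
        by (rule comm_result)
          (auto dest!: comm_apply_steps acts_steps_small
            simp: Assign gvar_eq_G[of v] checkP_label_def)
      ultimately show ?thesis by blast
    qed
  next
    fix c assume l: "l = Act c" and "joint P (V G) c P'"
    then obtain a b where ab: "\<gamma> a b = Some c" and t: "trans_m r (mspec E) (chi P {||})
      {#prelabel (Act a), checkP_label (V G) True, prelabel (Act b), checkP_label (V G) True#}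
      (chi P' {||})" unfolding joint_def by blast
    let ?\<alpha> = "{#prelabel (Act a), checkP_label (V G) True, prelabel (Act b),
      checkP_label (V G) True#} + {#?g, ?g#}"
    have "trans_m r (mspec E) (inner P (V G)) ?\<alpha> (inner P' (update l V G))"
      unfolding inner_def by (rule trans_m.par_both[OF t]) (auto simp: globs_trans Let_def l)
    moreover have "acts \<beta> = acts (mlab l)" if \<beta>: "comm_apply r (comm_G C) ?\<alpha> \<beta>" for \<beta>
    proof -
      \<comment> \<open>While both actions survive, the communication is enabled in either argument
        order. One of the two orders belongs to \<open>C\<close>, contradicting the normal
        form.\<close>
      have "acts \<beta> \<noteq> {#(NAct a, []), (NAct b, [])#}"
      proof
        assume *: "acts \<beta> = {#(NAct a, []), (NAct b, [])#}"
        have "{#(NAct a, []), (NAct b, [])#} \<subseteq># \<beta>"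
          unfolding *[symmetric] acts_def by simp
        then have "enabled ([NAct a, NAct b], NAct c) \<beta>" "enabled ([NAct b, NAct a], NAct c) \<beta>"
          by (auto simp: enabled_iff add_mset_commute intro!: exI[of _ "[]"])
        then show False
          using comm_apply_normal[OF \<beta> comm_G_non_cascading] C_has[OF ab] by (auto simp: comm_G_def)
      qed
      then show ?thesis
        using acts_steps_pair[OF comm_apply_steps[OF \<beta>], of a "[]" b] ab
        by (auto simp: l checkP_label_def)
    qed
    then have "\<exists>\<beta>. comm_apply r (comm_G C) ?\<alpha> \<beta> \<and>
        filter_mset (\<lambda>l. fst l \<notin> {NCheck}) \<beta> = mlab l"
      by (intro comm_result) (auto simp: l checkP_label_def)
    ultimately show ?thesis by blast
  qed
  moreover obtain n ds where "mlab l = {#(n, ds)#}" "n \<in> allowed B"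
    using assms(3) by (cases l) (auto simp: allowed_def)
  ultimately have "trans_m r (mspec E) (Psi C B P V) (mlab l) (Psi C B P' (update l V))"
    using Psi_transI by blast
  with P' show ?thesis by blast
qed

text \<open>Split by who moves. The translated expression alone leaves its checks unmatched;
  \<open>Globs\<close> alone can only report the value; if both move, the matching of checks fixes
  the summand of \<open>Globs\<close>.\<close>

lemma Psi_transD:
  assumes "par_sequential P" "trans_m r (mspec E) (Psi C B P V) \<mu> Q"
  obtains (val) "\<mu> = {#(NValue, [VarV G, DatV (V G)])#}" "Q = Psi C B P V"
  | (lab) l P' where "\<mu> = mlab l" "Q = Psi C B P' (update l V)" "par_sequential P'"
      "trans_pa \<gamma> E (P, V) l (P', update l V)" "l \<notin> Act ` B"
proof -
  let ?g = "(NCheckG, [DatV (V G), BoolV True]) :: ('a, 'd) alab"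
  obtain \<alpha> \<beta> R n ds where inner: "trans_m r (mspec E) (inner P (V G)) \<alpha> R"
    and ap: "comm_apply r (comm_G C) \<alpha> \<beta>"
    and vis: "filter_mset (\<lambda>l. fst l \<notin> {NCheck}) \<beta> = {#(n, ds)#}" and \<mu>: "\<mu> = {#(n, ds)#}"
    and n: "n \<in> allowed B"
    and Q: "Q = MAllow ((\<lambda>n. {#n#}) ` allowed B) (MHide {NCheck} (MComm (comm_G C) R))"
    using assms(2) unfolding Psi_trans by blast
  note bal = comm_visible_balance[OF ap vis n]
  have nonempty: "\<exists>k\<ge>1. participants \<alpha>' k" if "trans_m r (mspec E) (chi P {||}) \<alpha>' P'" for \<alpha>' P'
    using assms(1) that
  proof (cases rule: chi_transD)
    case alone
    then show ?thesis using alone_participants by blast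
  next
    case paired
    then show ?thesis using paired_participants one_le_numeral by blast
  next
    case (crowd k)
    then show ?thesis by (intro exI[of _ k]) simp
  qed
  from inner consider
    (left) P' where "trans_m r (mspec E) (chi P {||}) \<alpha> P'"
  | (right) R' where "trans_m r (mspec E) (MCall Globs [DVal (DatV (V G))]) \<alpha> R'"
      "R = MPar (chi P {||}) R'"
  | (both) \<alpha>1 \<alpha>2 P' R' where "trans_m r (mspec E) (chi P {||}) \<alpha>1 P'"
      "trans_m r (mspec E) (MCall Globs [DVal (DatV (V G))]) \<alpha>2 R'"
      "\<alpha> = \<alpha>1 + \<alpha>2" "R = MPar P' R'"
    unfolding inner_def m_simps(4) by blast
  then show thesis
  proof cases
    case left
    obtain k where "k \<ge> 1" "participants \<alpha> k" using nonempty[OF left] by blast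
    then show thesis using bal(1) by (auto simp: participants_def)
  next
    case right
    \<comment> \<open>Every other summand offers an \<open>NCheckG\<close> for which there is no
      \<open>NCheckP\<close>.\<close>
    have "\<alpha> = {#(NValue, [VarV G, DatV (V G)])#} \<and> R' = MCall Globs [DVal (DatV (V G))]"
      using right(1) bal(1) unfolding globs_trans Let_def by auto
    then show thesis using bal(4) val \<mu> Q right(2)
      by (auto simp: Psi_unfold inner_def split: if_splits)
  next
    case both
    obtain k where k: "k \<ge> 1" "participants \<alpha>1 k" using nonempty[OF both(1)] by blast
    have clean: "params NCheck \<alpha> = {#}" "params NAssign \<alpha> = {#}"
      using k(2) both(2,3) by (auto simp: participants_def globs_trans Let_def)
    note bal = bal[OF clean]
    \<comment> \<open>The balance of the whole multiset splits, as each kind of argument is supplied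
      by one side only.\<close>
    have eqP: "params NCheckP \<alpha>1 = params NCheckG \<alpha>2" "params NCheckP \<alpha>2 = {#}"
      "params NAssignP \<alpha>1 = params NAssignG \<alpha>2"
      using bal(1,2) k(2) both(2,3) by (auto simp: participants_def globs_trans Let_def)
    have sz: "size (params NCheckG \<alpha>2) \<le> 2" 
      using both(2) by (auto simp: globs_trans Let_def)
    show thesis
      using assms(1) both(1)
    proof (cases rule: chi_transD)
      case crowd
      then show thesis using eqP(1) sz by (auto simp: participants_def)
    next
      case alone
      then obtain l d b P'' where \<alpha>1: "\<alpha>1 = {#prelabel l, checkP_label d b#}" "P' = chi P'' {||}"
        "par_sequential P''"
        and tr: "b \<Longrightarrow> V G = d \<Longrightarrow> trans_pa \<gamma> E (P, V) l (P'', update l V)"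
        unfolding alone_def by blast
      have "params NCheckP \<alpha>1 = {#[DatV d, BoolV b]#}" by (cases l) (auto simp: \<alpha>1 checkP_label_def)
      then have G2: "params NCheckG \<alpha>2 = {#[DatV d, BoolV b]#}" using eqP(1) by simp
      \<comment> \<open>The check of \<open>Globs\<close> states the current value and
        \<open>True\<close>, so the guess was correct and the guards hold.\<close>
      then have db: "V G = d" b using both(2) by (auto simp: globs_trans Let_def)
      have "\<mu> = mlab l \<and> R' = MCall Globs [DVal (DatV (update l V G))]"
      proof (cases l)
        case (Act a)
        then have \<alpha>2: "\<alpha>2 = {#?g#}" "R' = MCall Globs [DVal (DatV (V G))]"
          using G2 both(2) eqP(3) unfolding globs_trans Let_def
          by (auto simp: \<alpha>1 checkP_label_def)
        have "acts \<alpha> = {#(NAct a, [])#}" using \<alpha>2 both(3) by (simp add: \<alpha>1 Act checkP_label_def)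
        then have "acts \<beta> = {#(NAct a, [])#}"
          using acts_steps_small[OF comm_apply_steps[OF ap]] by simp
        then show ?thesis using bal(5) \<alpha>2(2) by (auto simp: \<mu> Act split: if_splits)
      next
        case (Assign v e)
        then have "\<alpha>2 = {#?g, (NAssignG, [VarV G, DatV e])#} \<and> R' = MCall Globs [DVal (DatV e)]"
          using G2 both(2) eqP(3) unfolding globs_trans Let_def
          by (auto simp: \<alpha>1 checkP_label_def)
        moreover have "\<mu> = mlab l"
          using bal(3) eqP(3) both(3) calculation
          by (auto simp: \<mu> Assign \<alpha>1 checkP_label_def split: if_splits)
        ultimately show ?thesis by (simp add: Assign gvar_eq_G[of v])
      qed
      moreover have "l \<notin> Act ` B" using n \<mu> calculation by (auto simp: allowed_def)
      ultimately show thesis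
        using lab[of l P''] tr db \<alpha>1 Q both(4) by (auto simp: Psi_unfold inner_def)
    next
      case paired
      then obtain l1 d1 b1 l2 d2 b2 P'' where \<alpha>1:
        "\<alpha>1 = {#prelabel l1, checkP_label d1 b1, prelabel l2, checkP_label d2 b2#}"
        "P' = chi P'' {||}" "par_sequential P''"
        and tr: "\<And>a1 a2 c. l1 = Act a1 \<Longrightarrow> l2 = Act a2 \<Longrightarrow> \<gamma> a1 a2 = Some c \<Longrightarrow> b1 \<Longrightarrow> b2 \<Longrightarrow>
          V G = d1 \<Longrightarrow> V G = d2 \<Longrightarrow> trans_pa \<gamma> E (P, V) (Act c) (P'', V)"
        unfolding paired_def by blast
      have "params NCheckP \<alpha>1 = {#[DatV d1, BoolV b1], [DatV d2, BoolV b2]#}"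
        by (cases l1; cases l2) (auto simp: \<alpha>1 checkP_label_def)
      then have G2: "params NCheckG \<alpha>2 = {#[DatV d1, BoolV b1], [DatV d2, BoolV b2]#}"
        using eqP(1) by simp
      then have \<alpha>2: "\<alpha>2 = {#?g, ?g#}" "R' = MCall Globs [DVal (DatV (V G))]"
        and db: "V G = d1" b1 "V G = d2" b2
        using both(2) by (auto simp: globs_trans Let_def add_eq_conv_ex)
      \<comment> \<open>The summand of \<open>Globs\<close> with two checks offers no
        \<open>NAssignG\<close>, so neither participant assigns.\<close>
      have "params NAssignP \<alpha>1 = {#}" using eqP(3) \<alpha>2 by simp
      then obtain a1 a2 where l: "l1 = Act a1" "l2 = Act a2"
        by (cases l1; cases l2) (auto simp: \<alpha>1 checkP_label_def)
      have "acts \<alpha> = {#(NAct a1, []), (NAct a2, [])#}"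
        using \<alpha>2 both(3) by (simp add: \<alpha>1 l checkP_label_def)
      \<comment> \<open>A single visible label leaves room for at most one action, so the two
        actions must have communicated.\<close>
      moreover have "size (acts \<beta>) \<le> 1" unfolding bal(5) by simp
      ultimately obtain c where c: "\<gamma> a1 a2 = Some c" "acts \<beta> = {#(NAct c, [])#}"
        using acts_steps_pair[OF comm_apply_steps[OF ap], of a1 "[]" a2] by auto
      then have "n = NAct c" "ds = []" using bal(5) by (auto split: if_splits)
      then show thesis
        using lab[of "Act c" P''] tr[OF l c(1) db(2,4,1,3)] n \<mu> \<alpha>1(2,3) \<alpha>2(2) Q both(4)
        by (auto simp: Psi_unfold inner_def allowed_def)
    qed
  qed
qed

section \<open>Transfer of formulas\<close>

lemma mlab_inj: "mlab l = mlab l' \<longleftrightarrow> l = l'"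
  by (cases l; cases l') auto

lemma Encap_simulated:
  assumes "par_sequential P" "trans_pa \<gamma> E (Encap B P, V) l s"
  obtains P' where "s = (Encap B P', update l V)" "par_sequential P'"
    "trans_m r (mspec E) (Psi C B P V) (mlab l) (Psi C B P' (update l V))"
proof -
  obtain P' V' where *: "s = (Encap B P', V')" "trans_pa \<gamma> E (P, V) l (P', V')" "l \<notin> Act ` B"
    using assms(2) by (auto simp: pa_simps)
  then show thesis using Psi_trans_lab[OF assms(1) *(2,3)] that by auto
qed

text \<open>Value loops cannot interfere, since no \<open>mlab l\<close> has the name
  \<open>NValue\<close>.\<close>

lemma Psi_simulated:
  assumes "par_sequential P" "trans_m r (mspec E) (Psi C B P V) (mlab l) Q"
  obtains P' where "Q = Psi C B P' (update l V)" "par_sequential P'"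
    "trans_pa \<gamma> E (Encap B P, V) l (Encap B P', update l V)"
  using assms
proof (cases rule: Psi_transD)
  case val
  then show thesis by (cases l) auto
next
  case (lab l' P')
  then have "l' = l" by (simp add: mlab_inj)
  then show thesis using lab that by (auto intro: trans_pa.encap)
qed

text \<open>\<open>P\<close> and \<open>V\<close> are generalised because modalities move to other
  states. Each modality uses one simulation per direction; a check of the variable is decided by the
  value loop.\<close>

lemma sat_translation:
  assumes "par_sequential P"
  shows "sat_check \<gamma> E \<phi> (Encap B P, V) \<longleftrightarrow>
    sat (trans_m r (mspec E)) (theta \<phi>) (Psi C B P V)"
  using assms
proof (induction \<phi> arbitrary: P V)
  case (CCheck v e)
  have v: "v = G" by (rule gvar_eq_G)
  \<comment> \<open>A transition named \<open>NValue\<close> must be the value loop, which reports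
    \<open>V G\<close>.\<close>
  have "V v = e" if "trans_m r (mspec E) (Psi C B P V) {#(NValue, [VarV v, DatV e])#} Q" for Q
    using CCheck that
  proof (cases rule: Psi_transD)
    case val
    then show ?thesis by (simp add: v)
  next
    case (lab l P')
    then show ?thesis by (cases l) auto
  qed
  then show ?case using Psi_trans_value[of B P V] by (auto simp: v)
next
  case (CDia T \<phi>)
  show ?case (is "?L \<longleftrightarrow> ?R")
  proof
    assume ?L
    then obtain l s where l: "l \<in> T" "trans_pa \<gamma> E (Encap B P, V) l s" "sat_check \<gamma> E \<phi> s" by auto
    show ?R by (rule Encap_simulated[OF CDia.prems l(2)]) (use l CDia.IH in auto)
  next
    assume ?R
    then obtain l Q where l: "l \<in> T" "trans_m r (mspec E) (Psi C B P V) (mlab l) Q"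
      "sat (trans_m r (mspec E)) (theta \<phi>) Q" by auto
    show ?L by (rule Psi_simulated[OF CDia.prems l(2)]) (use l CDia.IH in fastforce)
  qed
next
  case (CBox T \<phi>)
  show ?case (is "?L \<longleftrightarrow> ?R")
  proof
    assume ?L
    have "sat (trans_m r (mspec E)) (theta \<phi>) Q"
      if "l \<in> T" "trans_m r (mspec E) (Psi C B P V) (mlab l) Q" for l Q
      by (rule Psi_simulated[OF CBox.prems that(2)]) (use \<open>?L\<close> that CBox.IH in fastforce)
    then show ?R by auto
  next
    assume ?R
    have "sat_check \<gamma> E \<phi> s" if "l \<in> T" "trans_pa \<gamma> E (Encap B P, V) l s" for l s
      by (rule Encap_simulated[OF CBox.prems that(2)]) (use \<open>?R\<close> that CBox.IH in fastforce)
    then show ?L by auto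
  qed
qed auto

end


theorem mainTheorem3:
  fixes \<gamma> :: "'a \<Rightarrow> 'a \<Rightarrow> 'a option"
    and E :: "'x \<Rightarrow> ('a, 'd, 'x) pexpr"
    and C\<gamma> :: "'a communication set"
    and r :: "'a communication rel"
    and P :: "('a, 'd, 'x) pexpr"
    and B :: "'a set"
    and V :: "'d valuation"
    and \<phi> :: "('a, 'd) hml_check"
  assumes "communication_function \<gamma>"
    and "\<forall>X. sequential (E X)"
    and "comm_choice \<gamma> C\<gamma>"
    and "well_order r"
    and "par_sequential P"
    and "wf_check \<phi>"
  shows "sat_check \<gamma> E \<phi> (Encap B P, V) \<longleftrightarrow>
    sat (trans_m r (mspec E)) (theta \<phi>) (Psi C\<gamma> B P V)"
proof -
  interpret translation \<gamma> E C\<gamma> r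
    using assms by unfold_locales auto
  show ?thesis using assms(5) by (rule sat_translation)
qed

end
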